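(* Let $R=k[x_1,\ldots,x_n]$ with $k$ a field, and let $I$ be a monomial ideal of $R$ with $\dim(R/I)=1$. Let $I=\bigcap_{i=1}^{r}Q_i$ be the canonical primary decomposition of $I$, and let $\mathfrak{m}=(x_1,\ldots,x_n)$. Then $$\omega(I)=\omega^{\bullet}(I)=\begin{cases}\max\Big\{e(Q_s),\ \sum_{i\ne s}e(Q_i)\Big\} & \text{if } \sqrt{Q_s}=\mathfrak{m}\text{ for some } s\in\{1,\ldots,r\},\\[4pt] \sum_{i=1}^{r}e(Q_i) & \text{otherwise.}\end{cases}$$
   Context: $\mathbb{N}=\{1,2,\ldots\}$. For $N\in\mathbb{N}$, an ideal $I$ of a commutative ring $R$ with unity is $N$-absorbing if whenever $f_1,\ldots,f_{N+1}\in R$ satisfy $f_1\cdots f_{N+1}\in I$, there is some $j$ such that the product of the $f_i$ with $i\ne j$ lies in $I$. $I$ is strongly $N$-absorbing if whenever ideals $I_1,\ldots,I_{N+1}$ of $R$ satisfy $I_1\cdots I_{N+1}\subseteq I$, there is some $j$ such that the product of the $I_i$ with $i\neq j$ is contained in $I$. $\omega(I)$ (resp. $\omega^{\bullet}(I)$) is the least $N\in\mathbb{N}$ for which $I$ is $N$-absorbing (resp. strongly $N$-absorbing), or $\infty$ if there is none; by convention $\omega(R)=\omega^{\bullet}(R)=0$. The Noether exponent $e(I)$ is the least $\mu\in\mathbb{N}$ with $(\sqrt{I})^{\mu}\subseteq I$ ($\infty$ if none), with $e(R)=0$. A monomial ideal of $k[x_1,\ldots,x_n]$ is an ideal generated by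 monomials. Every (proper) monomial ideal $I$ can be written as a finite intersection of ideals of the form $(x_{i_1}^{d_1},\ldots,x_{i_m}^{d_m})$ with $d_j\in\mathbb{N}$, and an irredundant presentation of this form (no member can be omitted) is unique; it is called the standard decomposition $I=\bigcap_{\ell=1}^{t}T_\ell$. Define $i\sim j$ iff $\sqrt{T_i}=\sqrt{T_j}$, and let $S_1,\ldots,S_r$ be the equivalence classes on $\{1,\ldots,t\}$. With $Q_i=\bigcap_{\ell\in S_i}T_\ell$ (a monomial primary ideal), the decomposition $I=\bigcap_{i=1}^{r}Q_i$ is called the canonical primary decomposition of $I$. *)

theory Defs
  imports
    "HOL-Algebra.Ideal_Product"
    "HOL-Algebra.QuotRing"
    "HOL-Algebra.Algebraic_Closure_Type"
    "HOL-Library.Poly_Mapping"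
    "HOL-Library.Extended_Nat"
begin

section \<open>Absorbing ideals of a commutative ring\<close>

text \<open>The \<open>N + 1\<close> factors are indexed by \<open>{..N}\<close>. Products of ideals are taken in the commutative
  monoid \<^const>\<open>ideals_set\<close>, whose unit is the whole ring.\<close>

definition absorbing :: "('a, 'b) ring_scheme \<Rightarrow> nat \<Rightarrow> 'a set \<Rightarrow> bool" where
  "absorbing R N I \<longleftrightarrow>
     (\<forall>f \<in> {..N} \<rightarrow> carrier R.
        (\<Otimes>\<^bsub>R\<^esub>i\<in>{..N}. f i) \<in> I \<longrightarrow> (\<exists>j\<in>{..N}. (\<Otimes>\<^bsub>R\<^esub>i\<in>{..N} - {j}. f i) \<in> I))"

definition strongly_absorbing :: "('a, 'b) ring_scheme \<Rightarrow> nat \<Rightarrow> 'a set \<Rightarrow> bool" where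
  "strongly_absorbing R N I \<longleftrightarrow>
     (\<forall>J \<in> {..N} \<rightarrow> {J. ideal J R}.
        (\<Otimes>\<^bsub>ideals_set R\<^esub>i\<in>{..N}. J i) \<subseteq> I \<longrightarrow>
        (\<exists>j\<in>{..N}. (\<Otimes>\<^bsub>ideals_set R\<^esub>i\<in>{..N} - {j}. J i) \<subseteq> I))"

text \<open>In \<open>omega\<close>, \<open>strong_omega\<close> and \<open>noether_exponent\<close> the infimum over the empty set is \<open>\<infinity>\<close>.\<close>

definition omega :: "('a, 'b) ring_scheme \<Rightarrow> 'a set \<Rightarrow> enat" where
  "omega R I = (if I = carrier R then 0 else Inf {enat N |N. N \<ge> 1 \<and> absorbing R N I})"

definition strong_omega :: "('a, 'b) ring_scheme \<Rightarrow> 'a set \<Rightarrow> enat" where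
  "strong_omega R I =
     (if I = carrier R then 0 else Inf {enat N |N. N \<ge> 1 \<and> strongly_absorbing R N I})"

definition ideal_radical :: "('a, 'b) ring_scheme \<Rightarrow> 'a set \<Rightarrow> 'a set" where
  "ideal_radical R I = {f \<in> carrier R. \<exists>m::nat. m \<ge> 1 \<and> f [^]\<^bsub>R\<^esub> m \<in> I}"

definition noether_exponent :: "('a, 'b) ring_scheme \<Rightarrow> 'a set \<Rightarrow> enat" where
  "noether_exponent R I =
     (if I = carrier R then 0
      else Inf {enat \<mu> |\<mu>. \<mu> \<ge> 1 \<and> ideal_radical R I [^]\<^bsub>ideals_set R\<^esub> \<mu> \<subseteq> I})"

text \<open>Krull dimension as the supremum of the lengths of chains of prime ideals. Since the values are
  in \<^typ>\<open>enat\<close>, the zero ring gets dimension \<open>0\<close>.\<close>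

definition krull_dim :: "('a, 'b) ring_scheme \<Rightarrow> enat" where
  "krull_dim R = Sup {enat l |l. \<exists>P :: nat \<Rightarrow> 'a set.
     (\<forall>i\<le>l. primeideal (P i) R) \<and> (\<forall>i<l. P i \<subset> P (Suc i))}"


section \<open>Monomial ideals\<close>

text \<open>The polynomial ring over a field \<open>'k\<close> in the variables indexed by the finite type \<open>'n\<close>:
  a polynomial is a finitely supported function from exponent vectors to coefficients.\<close>

type_synonym ('n, 'k) poly_n = "('n \<Rightarrow>\<^sub>0 nat) \<Rightarrow>\<^sub>0 'k"

abbreviation mpoly_ring :: "('n::finite, 'k::field) poly_n ring" where
  "mpoly_ring \<equiv> ring_of_type_algebra"

definition monomial :: "('n \<Rightarrow>\<^sub>0 nat) \<Rightarrow> ('n::finite, 'k::field) poly_n" where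
  "monomial a = Poly_Mapping.single a 1"

definition variable :: "'n \<Rightarrow> ('n::finite, 'k::field) poly_n" where
  "variable i = monomial (Poly_Mapping.single i 1)"

definition variables_ideal :: "('n::finite, 'k::field) poly_n set" where
  "variables_ideal = genideal mpoly_ring (range variable)"

definition monomial_ideal :: "('n::finite, 'k::field) poly_n set \<Rightarrow> bool" where
  "monomial_ideal I \<longleftrightarrow> (\<exists>A. I = genideal mpoly_ring (monomial ` A))"

text \<open>The ideals generated by positive powers of some of the variables. The empty set of variables
  is admitted and gives the zero ideal, which is the monomial ideal generated by no monomials.\<close>

definition pure_power_ideal :: "('n::finite, 'k::field) poly_n set \<Rightarrow> bool" where
  "pure_power_ideal T \<longleftrightarrow>
     (\<exists>A d. (\<forall>i\<in>A. d i \<ge> 1) \<and> T = genideal mpoly_ring ((\<lambda>i. variable i ^ d i) ` A))"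

text \<open>Irredundancy forces the members of a presentation to be distinct, so a presentation is a set of
  ideals. The empty intersection is \<open>UNIV = carrier mpoly_ring\<close>.\<close>

definition standard_decomposition ::
    "('n::finite, 'k::field) poly_n set \<Rightarrow> ('n, 'k) poly_n set set \<Rightarrow> bool" where
  "standard_decomposition I \<T> \<longleftrightarrow>
     finite \<T> \<and> (\<forall>T\<in>\<T>. pure_power_ideal T) \<and> I = \<Inter>\<T> \<and> (\<forall>T\<in>\<T>. \<Inter>(\<T> - {T}) \<noteq> I)"

text \<open>One component for each class of members with the same radical. The radical of a component is
  that common radical, so distinct classes give distinct components, and the components
  can be collected in a set.\<close>

definition canonical_primary_decomposition ::
    "('n::finite, 'k::field) poly_n set \<Rightarrow> ('n, 'k) poly_n set set \<Rightarrow> bool" where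
  "canonical_primary_decomposition I \<Q> \<longleftrightarrow>
     (\<exists>\<T>. standard_decomposition I \<T> \<and>
        \<Q> = Inter ` (\<T> // {(T, T'). T \<in> \<T> \<and> T' \<in> \<T> \<and>
                                 ideal_radical mpoly_ring T = ideal_radical mpoly_ring T'}))"

end

theory Submission
  imports Defs
begin

text \<open>
  For a set \<open>A\<close> of variables let \<open>P\<^sub>A\<close> be the prime ideal that they generate. A member of the standard
  decomposition is \<open>T = (x\<^sub>i^d\<^sub>i | i \<in> A)\<close>. It is \<open>P\<^sub>A\<close>-primary, and the monomial
  \<open>w\<^sub>T = \<Prod>x\<^sub>i^(d\<^sub>i - 1)\<close> has the largest degree \<open>D\<^sub>T\<close> among the monomials in the variables \<open>A\<close> outside
  \<open>T\<close>, so \<open>P\<^sub>A^m \<subseteq> T\<close> exactly for \<open>m > D\<^sub>T\<close>. A component \<open>Q\<close> of the canonical decomposition is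
  therefore \<open>P\<^sub>A\<close>-primary with \<open>e(Q) = D\<^sub>T + 1\<close>, where \<open>T\<close> is the member of its class with the largest
  \<open>D\<^sub>T\<close>. If some \<open>T\<close> had two variables \<open>p, q \<notin> A\<close>, then \<open>P\<^sub>A \<subset> P\<^bsub>A \<union> {p}\<^esub> \<subset> P\<^bsub>A \<union> {p, q}\<^esub>\<close> would make
  \<open>R/I\<close> at least two-dimensional. So every \<open>A\<close> is the set of all variables or misses exactly one, and
  the primes other than \<open>\<mm>\<close> are pairwise incomparable.

  Upper bound, for ideals (elements are the case of principal ideals): if a product of ideals lies
  in a \<open>P\<close>-primary \<open>Q\<close>, then the factors not contained in \<open>P\<close> can be dropped, and \<open>e(Q)\<close> of the
  remaining ones suffice. Hence \<open>\<Sum>e(Q\<^sub>i)\<close> factors suffice for an intersection. If an \<open>\<mm>\<close>-primary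
  \<open>Q\<^sub>s\<close> is present, the factors already chosen for the other components all lie in \<open>\<mm>\<close>; enlarging
  the choice within the factors contained in \<open>\<mm>\<close> costs nothing beyond \<open>e(Q\<^sub>s)\<close> factors in total, which
  is why a maximum and not a sum appears.

  Lower bound: a family of elements with product in \<open>I\<close>, such that no product with one factor omitted
  is in \<open>I\<close>, shows that \<open>I\<close> is not absorbing for any smaller number, because factors can be grouped. For one
  component take a factor \<open>x\<^sub>i\<close> for each variable in \<open>w\<^sub>T\<close>, and one further factor \<open>\<Sum>x\<^sub>i\<close>. The product
  lies in \<open>P\<^sub>A^(D\<^sub>T + 1)\<close>, while each product with one factor omitted contains the monomial \<open>w\<^sub>T\<close>. To
  combine the families of several incomparable components, replace \<open>x\<^sub>i\<close> by \<open>x\<^sub>i + \<Sum>x\<^sub>l^2\<close>: this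
  leaves the lowest terms alone and moves the factors out of all the other primes, where they can then be
  cancelled. If \<open>e(Q\<^sub>s) \<le> \<Sum>e(Q\<^sub>i)\<close>, the combined product lies in \<open>Q\<^sub>s\<close> automatically. If
  \<open>e(Q\<^sub>s)\<close> is larger, the family of \<open>Q\<^sub>s\<close> itself is used: irredundancy of the standard decomposition puts
  \<open>w\<^sub>T\<close> into all members except \<open>T\<close>, and \<open>w\<^sub>T x\<^sub>i \<in> T\<close>, so \<open>w\<^sub>T x\<^sub>i \<in> I\<close> for every variable \<open>x\<^sub>i\<close>.\<close>

section \<open>Ideal products and absorption in a commutative ring\<close>

lemma carrier_type_algebra [simp]: "carrier (ring_of_type_algebra :: 'a::comm_ring_1 ring) = UNIV"
  and mult_type_algebra [simp]: "x \<otimes>\<^bsub>(ring_of_type_algebra :: 'a ring)\<^esub> y = x * y"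
  and one_type_algebra [simp]: "\<one>\<^bsub>(ring_of_type_algebra :: 'a ring)\<^esub> = 1"
  and zero_type_algebra [simp]: "\<zero>\<^bsub>(ring_of_type_algebra :: 'a ring)\<^esub> = 0"
  and add_type_algebra [simp]: "x \<oplus>\<^bsub>(ring_of_type_algebra :: 'a ring)\<^esub> y = x + y"
  by (simp_all add: ring_of_type_algebra_def)

lemma nat_pow_type_algebra [simp]:
  "x [^]\<^bsub>(ring_of_type_algebra :: 'a::comm_ring_1 ring)\<^esub> (m::nat) = x ^ m"
proof -
  interpret cring "ring_of_type_algebra :: 'a ring" by (rule cring_from_type_algebra)
  show ?thesis by (induction m) (simp_all add: mult.commute)
qed

lemma finprod_type_algebra:
  assumes "finite S"
  shows "finprod (ring_of_type_algebra :: 'a::comm_ring_1 ring) f S = prod f S"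
proof -
  interpret cring "ring_of_type_algebra :: 'a ring" by (rule cring_from_type_algebra)
  show ?thesis using assms by (induction S rule: finite_induct) simp_all
qed

lemma ideal_type_algebra_iff:
  "ideal J (ring_of_type_algebra :: 'a::comm_ring_1 ring) \<longleftrightarrow>
     0 \<in> J \<and> (\<forall>x\<in>J. \<forall>y\<in>J. x + y \<in> J) \<and> (\<forall>x\<in>J. \<forall>r. r * x \<in> J)"
proof
  interpret cring "ring_of_type_algebra :: 'a ring" by (rule cring_from_type_algebra)
  assume J: "ideal J (ring_of_type_algebra :: 'a ring)"
  show "0 \<in> J \<and> (\<forall>x\<in>J. \<forall>y\<in>J. x + y \<in> J) \<and> (\<forall>x\<in>J. \<forall>r. r * x \<in> J)"
    using additive_subgroup.zero_closed[OF ideal.axioms(1)[OF J]]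
      additive_subgroup.a_closed[OF ideal.axioms(1)[OF J]] ideal.I_l_closed[OF J] by simp
next
  interpret cring "ring_of_type_algebra :: 'a ring" by (rule cring_from_type_algebra)
  assume J: "0 \<in> J \<and> (\<forall>x\<in>J. \<forall>y\<in>J. x + y \<in> J) \<and> (\<forall>x\<in>J. \<forall>r. r * x \<in> J)"
  have inv: "\<ominus>\<^bsub>(ring_of_type_algebra :: 'a ring)\<^esub> x = - x" for x :: 'a
    by (rule minus_equality) simp_all
  have "- x \<in> J" if "x \<in> J" for x
    using J that by (metis mult_minus1)
  then show "ideal J (ring_of_type_algebra :: 'a ring)"
    using J inv by (intro idealI ring_axioms add.subgroupI) (auto simp: mult.commute a_inv_def)
qed

lemma ideal_mult_closed:
  "ideal J (ring_of_type_algebra :: 'a::comm_ring_1 ring) \<Longrightarrow> x \<in> J \<Longrightarrow> r * x \<in> J"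
  by (simp add: ideal_type_algebra_iff)

lemma ideal_add_closed:
  "ideal J (ring_of_type_algebra :: 'a::comm_ring_1 ring) \<Longrightarrow> x \<in> J \<Longrightarrow> y \<in> J \<Longrightarrow> x + y \<in> J"
  by (simp add: ideal_type_algebra_iff)

lemma ideal_sum_closed:
  assumes "ideal J (ring_of_type_algebra :: 'a::comm_ring_1 ring)" "\<And>s. s \<in> S \<Longrightarrow> f s \<in> J"
  shows "sum f S \<in> J"
  using assms(2)
  by (induction S rule: infinite_finite_induct) (use assms(1) in \<open>auto simp: ideal_type_algebra_iff\<close>)

text \<open>Containment of a product of ideals in an ideal \<open>K\<close> only concerns products of single elements. This
predicate expresses it in that form, also for sets \<open>J i\<close> that are not ideals.\<close>

definition products_within :: "('i \<Rightarrow> 'a set) \<Rightarrow> 'i set \<Rightarrow> 'a::comm_monoid_mult set \<Rightarrow> bool" where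
  "products_within J S K \<longleftrightarrow> (\<forall>f. (\<forall>i\<in>S. f i \<in> J i) \<longrightarrow> prod f S \<in> K)"

lemma products_withinD:
  "products_within J S K \<Longrightarrow> (\<And>i. i \<in> S \<Longrightarrow> f i \<in> J i) \<Longrightarrow> prod f S \<in> K"
  by (simp add: products_within_def)

lemma ideal_prod_subset_iff:
  assumes "ideal K (ring_of_type_algebra :: 'a::comm_ring_1 ring)"
  shows "ideal_prod (ring_of_type_algebra :: 'a ring) J L \<subseteq> K \<longleftrightarrow> (\<forall>x\<in>J. \<forall>y\<in>L. x * y \<in> K)"
proof
  assume "ideal_prod (ring_of_type_algebra :: 'a ring) J L \<subseteq> K"
  then show "\<forall>x\<in>J. \<forall>y\<in>L. x * y \<in> K"
    using ideal_prod.prod[of _ J _ L "ring_of_type_algebra :: 'a ring"] by auto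
next
  assume *: "\<forall>x\<in>J. \<forall>y\<in>L. x * y \<in> K"
  show "ideal_prod (ring_of_type_algebra :: 'a ring) J L \<subseteq> K"
  proof
    fix z assume "z \<in> ideal_prod (ring_of_type_algebra :: 'a ring) J L"
    then show "z \<in> K"
      by induction (use * assms in \<open>auto simp: ideal_type_algebra_iff\<close>)
  qed
qed

lemma ideal_colon:
  assumes "ideal K (ring_of_type_algebra :: 'a::comm_ring_1 ring)"
  shows "ideal {y. x * y \<in> K} (ring_of_type_algebra :: 'a ring)"
  using assms by (auto simp: ideal_type_algebra_iff algebra_simps)

text \<open>Induction on the number of factors, for all \<open>K\<close> at once: \<open>J\<^sub>0 L \<subseteq> K\<close> says that \<open>L\<close> is contained in
the ideal \<open>{y. x * y \<in> K}\<close> for each \<open>x \<in> J\<^sub>0\<close>, and the induction hypothesis applies to that ideal.\<close>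

lemma finprod_ideals_subset_iff:
  assumes "finite S" "ideal K (ring_of_type_algebra :: 'a::comm_ring_1 ring)"
    and "\<And>i. i \<in> S \<Longrightarrow> ideal (J i) (ring_of_type_algebra :: 'a ring)"
  shows "finprod (ideals_set (ring_of_type_algebra :: 'a ring)) J S \<subseteq> K \<longleftrightarrow> products_within J S K"
  using assms
proof (induction S arbitrary: K rule: finite_induct)
  case empty
  interpret cring "ring_of_type_algebra :: 'a ring" by (rule cring_from_type_algebra)
  interpret M: comm_monoid "ideals_set (ring_of_type_algebra :: 'a ring)"
    by (rule ideals_set_is_comm_monoid)
  have "UNIV \<subseteq> K \<longleftrightarrow> 1 \<in> K"
    using empty(1) by (auto simp: ideal_type_algebra_iff)
  moreover have "finprod (ideals_set (ring_of_type_algebra :: 'a ring)) J {} = UNIV"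
    by (subst M.finprod_empty) (simp add: ideals_set_def)
  ultimately show ?case by (simp add: products_within_def)
next
  case (insert i S)
  interpret cring "ring_of_type_algebra :: 'a ring" by (rule cring_from_type_algebra)
  interpret M: comm_monoid "ideals_set (ring_of_type_algebra :: 'a ring)"
    by (rule ideals_set_is_comm_monoid)
  have J: "J \<in> insert i S \<rightarrow> carrier (ideals_set (ring_of_type_algebra :: 'a ring))"
    using insert.prems(2) by (auto simp: ideals_set_def)
  let ?P = "finprod (ideals_set (ring_of_type_algebra :: 'a ring)) J S"
  have "finprod (ideals_set (ring_of_type_algebra :: 'a ring)) J (insert i S)
      = ideal_prod (ring_of_type_algebra :: 'a ring) (J i) ?P"
    using M.finprod_insert[OF insert.hyps, of J] J by (simp add: ideals_set_def)
  then have "finprod (ideals_set (ring_of_type_algebra :: 'a ring)) J (insert i S) \<subseteq> K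
      \<longleftrightarrow> (\<forall>x\<in>J i. ?P \<subseteq> {y. x * y \<in> K})"
    using ideal_prod_subset_iff[OF insert.prems(1)] by auto
  also have "\<dots> \<longleftrightarrow> (\<forall>x\<in>J i. products_within J S {y. x * y \<in> K})"
    using insert.IH[OF ideal_colon[OF insert.prems(1)]] insert.prems(2) by simp
  also have "\<dots> \<longleftrightarrow> products_within J (insert i S) K"
  proof
    assume *: "\<forall>x\<in>J i. products_within J S {y. x * y \<in> K}"
    show "products_within J (insert i S) K"
      using * insert.hyps unfolding products_within_def by auto
  next
    assume *: "products_within J (insert i S) K"
    show "\<forall>x\<in>J i. products_within J S {y. x * y \<in> K}"
      unfolding products_within_def
    proof (intro ballI allI impI)
      fix x f assume "x \<in> J i" "\<forall>k\<in>S. f k \<in> J k"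
      then have "prod (f(i := x)) (insert i S) \<in> K"
        using * insert.hyps(2) unfolding products_within_def by (metis fun_upd_apply insert_iff)
      moreover have "prod (f(i := x)) S = prod f S"
        using insert.hyps(2) by (intro prod.cong) auto
      ultimately show "prod f S \<in> {y. x * y \<in> K}"
        using insert.hyps by simp
    qed
  qed
  finally show ?case .
qed

lemma ideal_power_subset_iff:
  assumes "ideal K (ring_of_type_algebra :: 'a::comm_ring_1 ring)"
    and "ideal J (ring_of_type_algebra :: 'a ring)"
  shows "J [^]\<^bsub>ideals_set (ring_of_type_algebra :: 'a ring)\<^esub> (m::nat) \<subseteq> K
    \<longleftrightarrow> products_within (\<lambda>_. J) {..<m} K"
proof -
  interpret cring "ring_of_type_algebra :: 'a ring" by (rule cring_from_type_algebra)
  interpret M: comm_monoid "ideals_set (ring_of_type_algebra :: 'a ring)"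
    by (rule ideals_set_is_comm_monoid)
  have "J [^]\<^bsub>ideals_set (ring_of_type_algebra :: 'a ring)\<^esub> m
      = finprod (ideals_set (ring_of_type_algebra :: 'a ring)) (\<lambda>_. J) {..<m}"
    using M.finprod_const[of J "{..<m}"] assms(2) by (simp add: ideals_set_def)
  then show ?thesis using finprod_ideals_subset_iff[OF _ assms(1), of "{..<m}"] assms(2) by simp
qed

lemma absorbing_type_algebra_iff:
  "absorbing (ring_of_type_algebra :: 'a::comm_ring_1 ring) N I \<longleftrightarrow>
     (\<forall>f. prod f {..N} \<in> I \<longrightarrow> (\<exists>j\<le>N. prod f ({..N} - {j}) \<in> I))"
  by (auto simp: absorbing_def finprod_type_algebra Bex_def)

lemma strongly_absorbing_type_algebra_iff:
  assumes "ideal I (ring_of_type_algebra :: 'a::comm_ring_1 ring)"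
  shows "strongly_absorbing (ring_of_type_algebra :: 'a ring) N I \<longleftrightarrow>
     (\<forall>J. (\<forall>i\<le>N. ideal (J i) (ring_of_type_algebra :: 'a ring)) \<longrightarrow> products_within J {..N} I
        \<longrightarrow> (\<exists>j\<le>N. products_within J ({..N} - {j}) I))"
proof -
  have "finprod (ideals_set (ring_of_type_algebra :: 'a ring)) J S \<subseteq> I \<longleftrightarrow> products_within J S I"
    if "\<forall>i\<le>N. ideal (J i) (ring_of_type_algebra :: 'a ring)" "S \<subseteq> {..N}" for J S
    using that by (intro finprod_ideals_subset_iff assms) (auto intro: finite_subset)
  then have *: "(finprod (ideals_set (ring_of_type_algebra :: 'a ring)) J {..N} \<subseteq> I \<longrightarrow>
        (\<exists>j\<in>{..N}. finprod (ideals_set (ring_of_type_algebra :: 'a ring)) J ({..N} - {j}) \<subseteq> I))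
      \<longleftrightarrow> (products_within J {..N} I \<longrightarrow> (\<exists>j\<le>N. products_within J ({..N} - {j}) I))"
    if "\<forall>i\<le>N. ideal (J i) (ring_of_type_algebra :: 'a ring)" for J
    using that by (simp add: Bex_def)
  show ?thesis
    unfolding strongly_absorbing_def using * by (auto simp: Pi_iff)
qed

lemma strongly_absorbing_imp_absorbing:
  assumes I: "ideal I (ring_of_type_algebra :: 'a::comm_ring_1 ring)"
    and "strongly_absorbing (ring_of_type_algebra :: 'a ring) N I"
  shows "absorbing (ring_of_type_algebra :: 'a ring) N I"
  unfolding absorbing_type_algebra_iff
proof (intro allI impI)
  fix f :: "nat \<Rightarrow> 'a" assume f: "prod f {..N} \<in> I"
  define J where "J i = {r * f i |r. True}" for i
  have "ideal (J i) (ring_of_type_algebra :: 'a ring)" for i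
    unfolding ideal_type_algebra_iff
  proof (intro conjI ballI allI)
    show "0 \<in> J i" unfolding J_def by (auto intro!: exI[of _ 0])
    show "x + y \<in> J i" if "x \<in> J i" "y \<in> J i" for x y
      using that unfolding J_def by (auto simp flip: distrib_right)
    show "r * x \<in> J i" if "x \<in> J i" for x r
      using that unfolding J_def by (auto simp flip: mult.assoc)
  qed
  moreover have "products_within J {..N} I"
    unfolding products_within_def
  proof (intro allI impI)
    fix g assume "\<forall>i\<in>{..N}. g i \<in> J i"
    then obtain r where "\<forall>i\<in>{..N}. g i = r i * f i"
      unfolding J_def by simp metis
    then have "prod g {..N} = prod r {..N} * prod f {..N}"
      by (simp add: prod.distrib)
    then show "prod g {..N} \<in> I" using f I by (simp add: ideal_type_algebra_iff)
  qed
  ultimately obtain j where "j \<le> N" "products_within J ({..N} - {j}) I"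
    using assms(2) unfolding strongly_absorbing_type_algebra_iff[OF I] by blast
  moreover have "f i \<in> J i" for i unfolding J_def by (metis (mono_tags) mem_Collect_eq mult_1)
  ultimately show "\<exists>j\<le>N. prod f ({..N} - {j}) \<in> I"
    unfolding products_within_def by blast
qed

text \<open>The tool for all lower bounds. If \<open>I\<close> were \<open>N\<close>-absorbing, distribute the factors onto \<open>N + 1\<close>
nonempty groups; one group could be omitted, and omitting a single element of that group leaves a
multiple of what remains.\<close>

lemma not_absorbing_if_critical_product:
  assumes I: "ideal I (ring_of_type_algebra :: 'a::comm_ring_1 ring)"
    and K: "finite K" "N < card K"
    and "prod g K \<in> I" and omit: "\<And>k. k \<in> K \<Longrightarrow> prod g (K - {k}) \<notin> I"
  shows "\<not> absorbing (ring_of_type_algebra :: 'a ring) N I"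
proof
  assume abs: "absorbing (ring_of_type_algebra :: 'a ring) N I"
  obtain h0 where h0: "bij_betw h0 K {..<card K}"
    using K(1) by (metis atLeast0LessThan ex_bij_betw_finite_nat)
  \<comment> \<open>The first \<open>N\<close> factors form groups of their own, all others go into group \<open>N\<close>.\<close>
  define h where "h k = min N (h0 k)" for k
  have onto: "\<exists>k\<in>K. h k = j" if "j \<le> N" for j
  proof -
    have "j \<in> h0 ` K" using h0 K(2) that by (auto simp: bij_betw_def)
    then show ?thesis using that by (force simp: h_def)
  qed
  define F where "F j = prod g {k \<in> K. h k = j}" for j
  have prodF: "prod F S = prod g {k \<in> K. h k \<in> S}" if "finite S" for S
  proof -
    have "prod F S = (\<Prod>j\<in>S. prod g {k \<in> {k \<in> K. h k \<in> S}. h k = j})"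
      unfolding F_def by (intro prod.cong) auto
    also have "\<dots> = prod g {k \<in> K. h k \<in> S}"
      using that K(1) by (intro prod.group) auto
    finally show ?thesis .
  qed
  have "{k \<in> K. h k \<in> {..N}} = K" by (auto simp: h_def)
  then have "prod F {..N} \<in> I" using prodF assms(4) by simp
  then obtain j where j: "j \<le> N" "prod F ({..N} - {j}) \<in> I"
    using abs by (auto simp: absorbing_type_algebra_iff)
  obtain k where k: "k \<in> K" "h k = j" using onto j(1) by blast
  let ?S = "{k \<in> K. h k \<in> {..N} - {j}}"
  have "prod g (K - {k}) = prod g (K - {k} - ?S) * prod g ?S"
    using K(1) k by (intro prod.subset_diff) auto
  then have "prod g (K - {k}) \<in> I"
    using j(2) prodF[of "{..N} - {j}"] I by (simp add: ideal_type_algebra_iff)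
  then show False using omit k(1) by blast
qed

lemma omega_eqI:
  assumes I: "ideal I (ring_of_type_algebra :: 'a::comm_ring_1 ring)" "I \<noteq> UNIV"
    and "N \<ge> 1" "strongly_absorbing (ring_of_type_algebra :: 'a ring) N I"
    and not: "\<And>N'. N' < N \<Longrightarrow> \<not> absorbing (ring_of_type_algebra :: 'a ring) N' I"
  shows "omega (ring_of_type_algebra :: 'a ring) I = enat N"
    and "strong_omega (ring_of_type_algebra :: 'a ring) I = enat N"
proof -
  have abs: "absorbing (ring_of_type_algebra :: 'a ring) N I"
    using strongly_absorbing_imp_absorbing assms by blast
  have le: "N \<le> M" if "absorbing (ring_of_type_algebra :: 'a ring) M I" for M
    using not that by (meson not_le_imp_less)
  show "omega (ring_of_type_algebra :: 'a ring) I = enat N"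
    unfolding omega_def using I(2) assms(3) abs le
    by (auto intro!: antisym[OF Inf_lower Inf_greatest])
  show "strong_omega (ring_of_type_algebra :: 'a ring) I = enat N"
    unfolding strong_omega_def using I assms(3,4) le strongly_absorbing_imp_absorbing
    by (auto intro!: antisym[OF Inf_lower Inf_greatest])
qed

section \<open>Leading exponents for a weight\<close>

abbreviation keys where "keys \<equiv> Poly_Mapping.keys"
abbreviation lookup where "lookup \<equiv> Poly_Mapping.lookup"
abbreviation single where "single \<equiv> Poly_Mapping.single"

text \<open>The exponent type carries no monomial order, since the index type of the variables need not be ordered. An
additive weight with a unique minimum on the support serves the same purpose.\<close>

definition leading :: "('a \<Rightarrow> nat) \<Rightarrow> ('a \<Rightarrow>\<^sub>0 'k::zero) \<Rightarrow> 'a \<Rightarrow> bool" where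
  "leading \<phi> f a \<longleftrightarrow> a \<in> keys f \<and> (\<forall>b\<in>keys f. b \<noteq> a \<longrightarrow> \<phi> a < \<phi> b)"

lemma lookup_mult_keys:
  fixes f g :: "'a::monoid_add \<Rightarrow>\<^sub>0 'k::semiring_0"
  shows "lookup (f * g) c = (\<Sum>a\<in>keys f. \<Sum>b\<in>keys g. lookup f a * lookup g b when c = a + b)"
proof -
  have inner: "(\<Sum>q. lookup g q when c = a + q) = (\<Sum>b\<in>keys g. lookup g b when c = a + b)" for a
  proof (rule Sum_any.expand_superset)
    show "{q. (lookup g q when c = a + q) \<noteq> 0} \<subseteq> keys g" by (auto simp: in_keys_iff)
  qed simp
  have "lookup (f * g) c = (\<Sum>a. lookup f a * (\<Sum>b\<in>keys g. lookup g b when c = a + b))"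
    by (simp add: lookup_mult inner)
  also have "\<dots> = (\<Sum>a\<in>keys f. lookup f a * (\<Sum>b\<in>keys g. lookup g b when c = a + b))"
  proof (rule Sum_any.expand_superset)
    show "{a. lookup f a * (\<Sum>b\<in>keys g. lookup g b when c = a + b) \<noteq> 0} \<subseteq> keys f"
      by (metis (mono_tags, lifting) mem_Collect_eq mult_zero_left not_in_keys_iff_lookup_eq_zero subsetI)
  qed simp
  also have "\<dots> = (\<Sum>a\<in>keys f. \<Sum>b\<in>keys g. lookup f a * lookup g b when c = a + b)"
    by (simp add: sum_distrib_left mult_when)
  finally show ?thesis .
qed

text \<open>The product of the two leading terms cannot cancel, because every other pair of terms has a larger weight.\<close>

lemma leading_mult:
  fixes f g :: "'a::comm_monoid_add \<Rightarrow>\<^sub>0 'k::semiring_no_zero_divisors"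
  assumes add: "\<And>a b. \<phi> (a + b) = \<phi> a + \<phi> b"
    and f: "leading \<phi> f a" and g: "leading \<phi> g b"
  shows "leading \<phi> (f * g) (a + b)"
proof -
  have less: "\<phi> (a + b) < \<phi> (a' + b')"
    if "a' \<in> keys f" "b' \<in> keys g" "(a', b') \<noteq> (a, b)" for a' b'
  proof -
    have "a' = a \<or> \<phi> a < \<phi> a'" "b' = b \<or> \<phi> b < \<phi> b'"
      using f g that(1,2) unfolding leading_def by blast+
    then show ?thesis using that(3) by (elim disjE) (simp_all add: add)
  qed
  have "lookup (f * g) (a + b)
      = (\<Sum>a'\<in>keys f. \<Sum>b'\<in>keys g. if b' = b then (if a' = a then lookup f a * lookup g b else 0) else 0)"
    unfolding lookup_mult_keys
  proof (intro sum.cong refl)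
    fix a' b' assume "a' \<in> keys f" "b' \<in> keys g"
    then show "(lookup f a' * lookup g b' when a + b = a' + b')
        = (if b' = b then (if a' = a then lookup f a * lookup g b else 0) else 0)"
    proof (cases "a' = a \<and> b' = b")
      case False
      then have "a + b \<noteq> a' + b'"
        using less[of a' b'] \<open>a' \<in> keys f\<close> \<open>b' \<in> keys g\<close> by (metis less_irrefl prod.inject)
      then show ?thesis using False by auto
    qed simp
  qed
  also have "\<dots> = lookup f a * lookup g b"
    using f g by (simp add: leading_def sum.delta)
  finally have "a + b \<in> keys (f * g)"
    using f g by (simp add: leading_def in_keys_iff)
  moreover have "\<phi> (a + b) < \<phi> c" if c: "c \<in> keys (f * g)" "c \<noteq> a + b" for c
  proof -
    obtain a' b' where "a' \<in> keys f" "b' \<in> keys g" "c = a' + b'"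
      using c(1) keys_mult[of f g] by blast
    then show ?thesis using less c(2) by auto
  qed
  ultimately show ?thesis by (auto simp: leading_def)
qed

lemma leading_prod:
  fixes f :: "'i \<Rightarrow> 'a::comm_monoid_add \<Rightarrow>\<^sub>0 'k::{comm_semiring_1, semiring_no_zero_divisors}"
  assumes add: "\<And>a b. \<phi> (a + b) = \<phi> a + \<phi> b"
    and "finite S" "\<And>i. i \<in> S \<Longrightarrow> leading \<phi> (f i) (a i)"
  shows "leading \<phi> (prod f S) (sum a S)"
  using assms(2,3)
proof (induction S rule: finite_induct)
  case empty
  show ?case by (simp add: leading_def)
next
  case (insert i S)
  then show ?case by (auto intro!: leading_mult add)
qed

lemma leading_exists:
  assumes "f \<noteq> 0" "inj_on \<phi> (keys f)"
  obtains a where "leading \<phi> f a"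
proof -
  define a where "a = arg_min_on \<phi> (keys f)"
  have "keys f \<noteq> {}" using assms(1) by simp
  then have "a \<in> keys f" "\<forall>b\<in>keys f. \<phi> a \<le> \<phi> b"
    unfolding a_def using arg_min_if_finite[of "keys f" \<phi>] by (auto simp: not_less)
  then have "leading \<phi> f a"
    unfolding leading_def using assms(2) by (metis inj_onD le_neq_trans)
  then show thesis by (rule that)
qed

section \<open>Ideals generated by powers of variables\<close>

text \<open>The ideal generated by the powers \<open>x\<^sub>i^d\<^sub>i\<close> with \<open>i \<in> A\<close>, described by the supports of its
elements; this agrees with the generated ideal by \<open>genideal_variable_powers\<close>. Taking all exponents
equal to \<open>1\<close> gives the coordinate prime of \<open>A\<close>.\<close>

definition pure_power :: "'n set \<Rightarrow> ('n \<Rightarrow> nat) \<Rightarrow> ('n::finite, 'k::field) poly_n set" where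
  "pure_power A d = {f. \<forall>a\<in>keys f. \<exists>i\<in>A. d i \<le> lookup a i}"

abbreviation coord_prime :: "'n set \<Rightarrow> ('n::finite, 'k::field) poly_n set" where
  "coord_prime A \<equiv> pure_power A (\<lambda>_. 1)"

lemma ideal_pure_power: "ideal (pure_power A d) mpoly_ring"
  unfolding ideal_type_algebra_iff
proof (intro conjI ballI allI)
  show "0 \<in> pure_power A d" by (simp add: pure_power_def)
  show "f + g \<in> pure_power A d" if "f \<in> pure_power A d" "g \<in> pure_power A d" for f g
    using that Poly_Mapping.keys_add[of f g] unfolding pure_power_def by blast
  show "r * f \<in> pure_power A d" if "f \<in> pure_power A d" for f r
    unfolding pure_power_def
  proof (intro CollectI ballI)
    fix c assume "c \<in> keys (r * f)"
    then obtain b a where "a \<in> keys f" "c = b + a" using keys_mult[of r f] by blast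
    then show "\<exists>i\<in>A. d i \<le> lookup c i"
      using that unfolding pure_power_def by (auto simp: lookup_add intro: trans_le_add2)
  qed
qed

lemma variable_power: "variable i ^ m = (single (single i m) 1 :: ('n::finite, 'k::field) poly_n)"
proof (induction m)
  case 0
  then show ?case by simp
next
  case (Suc m)
  then show ?case
    by (simp add: variable_def monomial_def mult_single flip: single_add)
qed

lemma sum_single_keys: "f = (\<Sum>a\<in>keys f. single a (lookup f a))"
  by (rule poly_mapping_eqI)
    (simp add: lookup_sum lookup_single when_def sum.delta' in_keys_iff cong: if_cong)

lemma genideal_variable_powers:
  "genideal mpoly_ring ((\<lambda>i. variable i ^ d i) ` A) = (pure_power A d :: ('n::finite, 'k::field) poly_n set)"
proof -
  interpret cring "mpoly_ring :: ('n, 'k) poly_n ring" by (rule cring_from_type_algebra)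
  let ?G = "(\<lambda>i. variable i ^ d i) ` A :: ('n, 'k) poly_n set"
  let ?I = "genideal mpoly_ring ?G"
  have I: "ideal ?I mpoly_ring" by (rule genideal_ideal) simp
  show ?thesis
  proof
    have "?G \<subseteq> pure_power A d"
    proof (rule image_subsetI)
      fix i assume "i \<in> A"
      then have "\<exists>j\<in>A. d j \<le> lookup (single i (d i)) j" by (intro bexI[of _ i]) simp_all
      then show "variable i ^ d i \<in> pure_power A d" by (simp add: variable_power pure_power_def)
    qed
    then show "?I \<subseteq> pure_power A d" by (rule genideal_minimal[OF ideal_pure_power])
    show "pure_power A d \<subseteq> ?I"
    proof
      fix f :: "('n, 'k) poly_n" assume f: "f \<in> pure_power A d"
      have "single a c \<in> ?I" if a: "a \<in> keys f" for a c
      proof -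
        obtain i where i: "i \<in> A" "d i \<le> lookup a i"
          using f a by (auto simp: pure_power_def)
        have "(a - single i (d i)) + single i (d i) = a"
          using i(2) by (intro poly_mapping_eqI) (auto simp: lookup_add lookup_minus lookup_single when_def)
        then have "single a c = single (a - single i (d i)) c * variable i ^ d i"
          by (simp add: variable_power mult_single)
        moreover have "variable i ^ d i \<in> ?I"
          using genideal_self[of ?G] i(1) by auto
        ultimately show ?thesis using I by (simp add: ideal_type_algebra_iff)
      qed
      then have "(\<Sum>a\<in>keys f. single a (lookup f a)) \<in> ?I"
        by (intro ideal_sum_closed[OF I])
      then show "f \<in> ?I" by (simp flip: sum_single_keys)
    qed
  qed
qed

lemma variables_ideal_eq: "variables_ideal = (coord_prime UNIV :: ('n::finite, 'k::field) poly_n set)"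
  using genideal_variable_powers[of "\<lambda>_. 1" UNIV] by (simp add: variables_ideal_def)

lemma pure_power_ideal_iff:
  "pure_power_ideal T \<longleftrightarrow> (\<exists>A d. (\<forall>i\<in>A. d i \<ge> 1) \<and> T = pure_power A d)"
  by (simp add: pure_power_ideal_def genideal_variable_powers)

lemma coord_prime_antimono_iff:
  "coord_prime A \<subseteq> (coord_prime B :: ('n::finite, 'k::field) poly_n set) \<longleftrightarrow> A \<subseteq> B"
proof
  assume sub: "coord_prime A \<subseteq> (coord_prime B :: ('n, 'k) poly_n set)"
  show "A \<subseteq> B"
  proof
    fix i assume "i \<in> A"
    then have "single (single i 1) 1 \<in> (coord_prime A :: ('n, 'k) poly_n set)"
      by (auto simp: pure_power_def intro!: bexI[of _ i])
    then show "i \<in> B" using sub[THEN subsetD, of "single (single i 1) 1"]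
      by (auto simp: pure_power_def lookup_single when_def split: if_splits)
  qed
next
  assume "A \<subseteq> B"
  then show "coord_prime A \<subseteq> (coord_prime B :: ('n, 'k) poly_n set)"
    unfolding pure_power_def by blast
qed

lemma pure_power_subset_coord_prime:
  assumes "\<forall>i\<in>A. d i \<ge> 1"
  shows "pure_power A d \<subseteq> coord_prime A"
  using assms unfolding pure_power_def by (force intro: order_trans)

lemma one_notin_pure_power:
  assumes "\<forall>i\<in>A. d i \<ge> 1"
  shows "1 \<notin> pure_power A d"
  using assms by (force simp: pure_power_def)

text \<open>The weight \<open>u + M v\<close> with \<open>M\<close> larger than all values of \<open>u\<close>: two digits in base \<open>M\<close>, of which
\<open>v\<close> is the more significant one.\<close>

lemma additive_digit_extension:
  fixes u v :: "'a::plus \<Rightarrow> nat"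
  assumes "finite E" "\<forall>a b. u (a + b) = u a + u b" "\<forall>a b. v (a + b) = v a + v b"
  shows "\<exists>\<phi> :: 'a \<Rightarrow> nat. (\<forall>a b. \<phi> (a + b) = \<phi> a + \<phi> b) \<and>
    (\<forall>a\<in>E. \<forall>b\<in>E. \<phi> a = \<phi> b \<longrightarrow> u a = u b \<and> v a = v b) \<and>
    (\<forall>a\<in>E. \<forall>b\<in>E. v a < v b \<longrightarrow> \<phi> a < \<phi> b)"
proof -
  define M where "M = Suc (Max (u ` E))"
  have small: "u a < M" if "a \<in> E" for a
    using assms(1) that by (simp add: M_def less_Suc_eq_le)
  have add: "u (a + b) + M * v (a + b) = (u a + M * v a) + (u b + M * v b)" for a b
    by (simp add: assms(2,3) algebra_simps)
  have lt: "u a + M * v a < u b + M * v b" if "a \<in> E" "v a < v b" for a b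
  proof -
    have "u a + M * v a < M * Suc (v a)" using small that(1) by simp
    also have "\<dots> \<le> M * v b" using that(2) by (intro mult_le_mono) auto
    finally show ?thesis by simp
  qed
  have eq: "u a = u b \<and> v a = v b" if "a \<in> E" "b \<in> E" "u a + M * v a = u b + M * v b" for a b
    using lt[of a b] lt[of b a] that by (cases "v a" "v b" rule: linorder_cases) auto
  show ?thesis
  proof (intro exI[of _ "\<lambda>a. u a + M * v a"] conjI ballI allI impI)
    fix a b assume "a \<in> E" "b \<in> E" "u a + M * v a = u b + M * v b"
    then show "u a = u b" "v a = v b" using eq by blast+
  qed (rule add, rule lt)
qed

text \<open>A substitute for a monomial order that compares the degree in the variables \<open>A\<close> first. The weight depends on the
finite set \<open>E\<close> of exponents on which it has to be injective; it is built by adding one digit per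
variable, and the degree in \<open>A\<close> as the last and most significant digit.\<close>

lemma separating_weight:
  fixes E :: "('n::finite \<Rightarrow>\<^sub>0 nat) set"
  assumes E: "finite E"
  shows "\<exists>\<phi> :: ('n \<Rightarrow>\<^sub>0 nat) \<Rightarrow> nat. (\<forall>a b. \<phi> (a + b) = \<phi> a + \<phi> b) \<and> inj_on \<phi> E \<and>
    (\<forall>a\<in>E. \<forall>b\<in>E. (\<forall>i\<in>A. lookup a i = 0) \<longrightarrow> (\<exists>i\<in>A. lookup b i \<noteq> 0) \<longrightarrow> \<phi> a < \<phi> b)"
proof -
  have "\<exists>u :: ('n \<Rightarrow>\<^sub>0 nat) \<Rightarrow> nat. (\<forall>a b. u (a + b) = u a + u b) \<and>
      (\<forall>a\<in>E. \<forall>b\<in>E. u a = u b \<longrightarrow> (\<forall>i\<in>V. lookup a i = lookup b i))"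
    if "finite V" for V :: "'n set"
    using that
  proof (induction V rule: finite_induct)
    case empty
    show ?case by (intro exI[of _ "\<lambda>_. 0"]) simp
  next
    case (insert i V)
    from insert.IH obtain u :: "('n \<Rightarrow>\<^sub>0 nat) \<Rightarrow> nat" where u: "\<forall>a b. u (a + b) = u a + u b"
      and inj: "\<forall>a\<in>E. \<forall>b\<in>E. u a = u b \<longrightarrow> (\<forall>i\<in>V. lookup a i = lookup b i)"
      by blast
    have "\<forall>a b. lookup (a + b) i = lookup a i + lookup b i" by (simp add: lookup_add)
    from additive_digit_extension[OF E u this]
    obtain \<phi> :: "('n \<Rightarrow>\<^sub>0 nat) \<Rightarrow> nat" where \<phi>: "\<forall>a b. \<phi> (a + b) = \<phi> a + \<phi> b"
      "\<forall>a\<in>E. \<forall>b\<in>E. \<phi> a = \<phi> b \<longrightarrow> u a = u b \<and> lookup a i = lookup b i"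
      by blast
    show ?case
    proof (intro exI[of _ \<phi>] conjI ballI impI \<phi>(1))
      fix a b j assume ab: "a \<in> E" "b \<in> E" "\<phi> a = \<phi> b" and j: "j \<in> insert i V"
      from \<phi>(2) ab have "u a = u b" "lookup a i = lookup b i" by blast+
      then show "lookup a j = lookup b j" using inj ab(1,2) j by blast
    qed
  qed
  from this[of UNIV, OF finite] obtain u :: "('n \<Rightarrow>\<^sub>0 nat) \<Rightarrow> nat"
    where u: "\<forall>a b. u (a + b) = u a + u b"
    and inj: "\<forall>a\<in>E. \<forall>b\<in>E. u a = u b \<longrightarrow> (\<forall>i\<in>UNIV. lookup a i = lookup b i)"
    by blast
  have "\<forall>a b. (\<Sum>i\<in>A. lookup (a + b) i) = (\<Sum>i\<in>A. lookup a i) + (\<Sum>i\<in>A. lookup b i)"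
    by (simp add: lookup_add sum.distrib)
  from additive_digit_extension[OF E u this]
  obtain \<phi> :: "('n \<Rightarrow>\<^sub>0 nat) \<Rightarrow> nat" where \<phi>: "\<forall>a b. \<phi> (a + b) = \<phi> a + \<phi> b"
    "\<forall>a\<in>E. \<forall>b\<in>E. \<phi> a = \<phi> b \<longrightarrow> u a = u b \<and> (\<Sum>i\<in>A. lookup a i) = (\<Sum>i\<in>A. lookup b i)"
    "\<forall>a\<in>E. \<forall>b\<in>E. (\<Sum>i\<in>A. lookup a i) < (\<Sum>i\<in>A. lookup b i) \<longrightarrow> \<phi> a < \<phi> b"
    by blast
  have "inj_on \<phi> E"
    using \<phi>(2) inj by (intro inj_onI poly_mapping_eqI) blast
  moreover have "\<phi> a < \<phi> b"
    if "a \<in> E" "b \<in> E" "\<forall>i\<in>A. lookup a i = 0" "\<exists>i\<in>A. lookup b i \<noteq> 0" for a b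
  proof -
    from that(4) obtain i where "i \<in> A" "0 < lookup b i" by auto
    then have "0 < (\<Sum>i\<in>A. lookup b i)" by (intro sum_pos2) auto
    moreover have "(\<Sum>i\<in>A. lookup a i) = 0" using that(3) by simp
    ultimately show ?thesis using \<phi>(3) that(1,2) by metis
  qed
  ultimately show ?thesis using \<phi>(1) by blast
qed

text \<open>Discard the terms of \<open>f\<close> that lie in the ideal. With a weight that compares the degree in \<open>A\<close>
first, the leading exponent of \<open>g\<close> involves no variable of \<open>A\<close>, so the leading exponent of the
product has the same \<open>A\<close>-part as that of the rest of \<open>f\<close>, and hence is not in the ideal.\<close>

lemma pure_power_primary:
  fixes f g :: "('n::finite, 'k::field) poly_n"
  assumes fg: "f * g \<in> pure_power A d" and g: "g \<notin> coord_prime A"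
  shows "f \<in> pure_power A d"
proof (rule ccontr)
  assume f: "f \<notin> pure_power A d"
  define f0 where "f0 = (\<Sum>a\<in>{a\<in>keys f. \<forall>i\<in>A. lookup a i < d i}. single a (lookup f a))"
  have lookup_f0: "lookup f0 a = (if \<forall>i\<in>A. lookup a i < d i then lookup f a else 0)" for a
    unfolding f0_def
    by (simp add: lookup_sum lookup_single when_def sum.delta' in_keys_iff cong: if_cong)
  have keys_f0: "keys f0 = {a\<in>keys f. \<forall>i\<in>A. lookup a i < d i}"
    by (intro subset_antisym subsetI) (auto simp: in_keys_iff lookup_f0 split: if_splits)
  have diff: "f - f0 \<in> pure_power A d"
    unfolding pure_power_def
  proof (intro CollectI ballI)
    fix a assume "a \<in> keys (f - f0)"
    then have "\<not> (\<forall>i\<in>A. lookup a i < d i)"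
      by (auto simp: in_keys_iff lookup_minus lookup_f0 split: if_splits)
    then show "\<exists>i\<in>A. d i \<le> lookup a i" by (auto simp: not_less)
  qed
  have "f * g - (f - f0) * g \<in> pure_power A d"
  proof -
    have "(- g) * (f - f0) \<in> pure_power A d"
      by (rule ideal_mult_closed[OF ideal_pure_power diff])
    then have "f * g + (- g) * (f - f0) \<in> pure_power A d"
      by (rule ideal_add_closed[OF ideal_pure_power fg])
    then show ?thesis by (simp add: algebra_simps)
  qed
  then have f0g: "f0 * g \<in> pure_power A d" by (simp add: algebra_simps)
  have "finite (keys f0 \<union> keys g)" by simp
  from separating_weight[OF this, of A]
  obtain \<phi> :: "('n \<Rightarrow>\<^sub>0 nat) \<Rightarrow> nat" where \<phi>: "\<forall>a b. \<phi> (a + b) = \<phi> a + \<phi> b"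
    "inj_on \<phi> (keys f0 \<union> keys g)"
    "\<forall>a\<in>keys f0 \<union> keys g. \<forall>b\<in>keys f0 \<union> keys g.
      (\<forall>i\<in>A. lookup a i = 0) \<longrightarrow> (\<exists>i\<in>A. lookup b i \<noteq> 0) \<longrightarrow> \<phi> a < \<phi> b"
    by auto
  have "keys f0 \<noteq> {}" "keys g \<noteq> {}"
    using f g unfolding keys_f0 by (auto simp: pure_power_def not_le)
  then have "f0 \<noteq> 0" "g \<noteq> 0" by auto
  moreover have "inj_on \<phi> (keys f0)" "inj_on \<phi> (keys g)"
    using \<phi>(2) by (auto intro: inj_on_subset)
  ultimately obtain a b where a: "leading \<phi> f0 a" and b: "leading \<phi> g b"
    by (meson leading_exists)
  have "\<forall>i\<in>A. lookup b i = 0"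
  proof (rule ccontr)
    assume nz: "\<not> (\<forall>i\<in>A. lookup b i = 0)"
    obtain c where c: "c \<in> keys g" "\<forall>i\<in>A. lookup c i = 0"
      using g by (auto simp: pure_power_def not_le)
    have "b \<in> keys g" using b by (simp add: leading_def)
    then have "\<phi> c < \<phi> b" using \<phi>(3) c nz by simp
    moreover have "\<phi> b \<le> \<phi> c" using b c by (cases "c = b") (auto simp: leading_def)
    ultimately show False by simp
  qed
  moreover have "a + b \<in> keys (f0 * g)"
    using leading_mult[OF \<phi>(1)[rule_format] a b] by (simp add: leading_def)
  ultimately show False
    using f0g a unfolding pure_power_def leading_def keys_f0
    by (fastforce simp: lookup_add)
qed

section \<open>Primary components and their Noether exponents\<close>

text \<open>The degree of the monomial \<open>\<Prod>x\<^sub>i^(d\<^sub>i - 1)\<close>, so that the Noether exponent of \<open>pure_power A d\<close> is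
\<open>excess A d + 1\<close>.\<close>

definition excess :: "'n set \<Rightarrow> ('n \<Rightarrow> nat) \<Rightarrow> nat" where
  "excess A d = (\<Sum>i\<in>A. d i - 1)"

text \<open>The componentwise largest exponent vector in the variables \<open>A\<close> outside \<open>pure_power A d\<close>. Its
monomial spans the socle of the quotient of \<open>k[x\<^sub>i | i \<in> A]\<close> by the powers \<open>x\<^sub>i^d\<^sub>i\<close>.\<close>

definition top_exponent :: "'n::finite set \<Rightarrow> ('n \<Rightarrow> nat) \<Rightarrow> 'n \<Rightarrow>\<^sub>0 nat" where
  "top_exponent A d = (\<Sum>i\<in>A. single i (d i - 1))"

lemma lookup_top_exponent: "lookup (top_exponent A d) i = (if i \<in> A then d i - 1 else 0)"
  by (simp add: top_exponent_def lookup_sum lookup_single when_def sum.delta' cong: if_cong)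

lemma notin_pure_power_if_top_exponent:
  assumes "\<forall>i\<in>A. 1 \<le> d i" "top_exponent A d \<in> keys f"
  shows "f \<notin> pure_power A d"
proof
  assume "f \<in> pure_power A d"
  then obtain i where "i \<in> A" "d i \<le> d i - 1"
    using assms(2) by (auto simp: pure_power_def lookup_top_exponent split: if_splits)
  then show False using assms(1) by fastforce
qed

lemma keys_prod_degree:
  assumes "finite S" "\<forall>s\<in>S. f s \<in> (coord_prime A :: ('n::finite, 'k::field) poly_n set)"
    and "a \<in> keys (prod f S)"
  shows "card S \<le> (\<Sum>i\<in>A. lookup a i)"
  using assms
proof (induction S arbitrary: a rule: finite_induct)
  case (insert s S)
  have "a \<in> keys (f s * prod f S)" using insert.prems(2) insert.hyps by simp
  then obtain b c where b: "b \<in> keys (f s)" and c: "c \<in> keys (prod f S)" and a: "a = b + c"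
    using keys_mult[of "f s" "prod f S"] by blast
  obtain i where "i \<in> A" "1 \<le> lookup b i"
    using insert.prems(1) b by (auto simp: pure_power_def)
  then have "0 < (\<Sum>i\<in>A. lookup b i)" by (intro sum_pos2) auto
  moreover have "card S \<le> (\<Sum>i\<in>A. lookup c i)" using insert.IH[OF _ c] insert.prems(1) by simp
  ultimately show ?case using insert.hyps by (simp add: a lookup_add sum.distrib)
qed simp

text \<open>Pigeonhole: a monomial with degree larger than \<open>\<Sum>(d\<^sub>i - 1)\<close> in the variables \<open>A\<close> has an
exponent that is at least \<open>d\<^sub>i\<close>.\<close>

lemma products_within_pure_power:
  fixes A :: "'n::finite set"
  assumes "finite S" "excess A d < card S"
  shows "products_within (\<lambda>_. coord_prime A) S (pure_power A d :: ('n, 'k::field) poly_n set)"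
  unfolding products_within_def
proof (intro allI impI)
  fix f :: "_ \<Rightarrow> ('n, 'k) poly_n" assume f: "\<forall>s\<in>S. f s \<in> coord_prime A"
  have "\<exists>i\<in>A. d i \<le> lookup a i" if a: "a \<in> keys (prod f S)" for a
  proof (rule ccontr)
    assume "\<not> (\<exists>i\<in>A. d i \<le> lookup a i)"
    then have "(\<Sum>i\<in>A. lookup a i) \<le> excess A d"
      unfolding excess_def by (intro sum_mono) force
    then show False using keys_prod_degree[OF assms(1) f a] assms(2) by simp
  qed
  then show "prod f S \<in> pure_power A d" by (simp add: pure_power_def)
qed

lemma products_within_const_mono:
  assumes K: "ideal K (ring_of_type_algebra :: 'a::comm_ring_1 ring)"
    and "products_within (\<lambda>_. J) {..<m} K" "finite S" "m \<le> card S"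
  shows "products_within (\<lambda>_. J) S K"
  unfolding products_within_def
proof (intro allI impI)
  fix f :: "_ \<Rightarrow> 'a" assume f: "\<forall>s\<in>S. f s \<in> J"
  obtain S' where S': "S' \<subseteq> S" "card S' = m" "finite S'"
    using obtain_subset_with_card_n[OF assms(4)] by blast
  then obtain h where h: "bij_betw h {..<m} S'"
    using ex_bij_betw_nat_finite[OF S'(3)] by (auto simp: atLeast0LessThan)
  have "\<forall>i\<in>{..<m}. f (h i) \<in> J" using f S'(1) bij_betwE[OF h] by blast
  then have "prod (\<lambda>i. f (h i)) {..<m} \<in> K"
    using assms(2)[unfolded products_within_def] by simp
  then have "prod f S' \<in> K" using prod.reindex_bij_betw[OF h, of f] by simp
  then have "prod f (S - S') * prod f S' \<in> K" by (rule ideal_mult_closed[OF K])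
  then show "prod f S \<in> K" using prod.subset_diff[OF S'(1) assms(3), of f] by simp
qed

text \<open>An index set for the variables that occur in the top monomial, each with its multiplicity.\<close>

definition monomial_factors :: "'n set \<Rightarrow> ('n \<Rightarrow> nat) \<Rightarrow> ('n \<times> nat) set" where
  "monomial_factors A d = (SIGMA i:A. {..<d i - 1})"

lemma finite_monomial_factors [simp]: "finite (monomial_factors A d)" for A :: "'n::finite set"
  by (simp add: monomial_factors_def)

lemma card_monomial_factors: "card (monomial_factors A d) = excess A d" for A :: "'n::finite set"
  by (simp add: monomial_factors_def excess_def)

lemma sum_monomial_factors:
  "(\<Sum>p\<in>monomial_factors A d. single (fst p) 1) = top_exponent A d" for A :: "'n::finite set"
proof -
  have "(\<Sum>c<m. single i (1::nat)) = single i m" for i :: 'n and m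
    by (induction m) (simp_all flip: single_add)
  moreover have "(\<Sum>p\<in>monomial_factors A d. single (fst p) 1) = (\<Sum>i\<in>A. \<Sum>c<d i - 1. single i (1::nat))"
    unfolding monomial_factors_def by (subst sum.Sigma) (auto simp: case_prod_beta)
  ultimately show ?thesis by (simp only: top_exponent_def)
qed

lemma prod_variables: "(\<Prod>p\<in>S. variable (v p)) = monomial (\<Sum>p\<in>S. single (v p) 1)"
  by (induction S rule: infinite_finite_induct)
    (simp_all add: variable_def monomial_def mult_single)

lemma prod_monomial_factors:
  "(\<Prod>p\<in>monomial_factors A d. variable (fst p)) = monomial (top_exponent A d)"
  unfolding prod_variables sum_monomial_factors ..

lemma variable_in_coord_prime: "i \<in> A \<Longrightarrow> variable i \<in> coord_prime A"
  by (auto simp: pure_power_def variable_def monomial_def intro!: bexI[of _ i])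

text \<open>The properties of a component of the canonical decomposition on which all bounds rest: it is primary for
the coordinate prime of \<open>A\<close>, and the member \<open>pure_power A d\<close> of its class alone determines which
powers of that prime it contains.\<close>

definition primary_component ::
    "('n::finite, 'k::field) poly_n set \<Rightarrow> 'n set \<Rightarrow> ('n \<Rightarrow> nat) \<Rightarrow> bool" where
  "primary_component Q A d \<longleftrightarrow> (\<forall>i\<in>A. 1 \<le> d i) \<and> ideal Q mpoly_ring \<and> Q \<subseteq> pure_power A d \<and>
     (\<forall>f g. f * g \<in> Q \<longrightarrow> g \<notin> coord_prime A \<longrightarrow> f \<in> Q) \<and>
     products_within (\<lambda>_. coord_prime A) {..<Suc (excess A d)} Q"

lemma primary_componentD:
  assumes "primary_component Q A d"
  shows "\<forall>i\<in>A. 1 \<le> d i" "ideal Q mpoly_ring" "Q \<subseteq> pure_power A d"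
    "f * g \<in> Q \<Longrightarrow> g \<notin> coord_prime A \<Longrightarrow> f \<in> Q"
    "products_within (\<lambda>_. coord_prime A) {..<Suc (excess A d)} Q"
  using assms unfolding primary_component_def by blast+

lemma primary_component_pure_power:
  assumes "\<forall>i\<in>A. 1 \<le> d i"
  shows "primary_component (pure_power A d) A d"
  unfolding primary_component_def
proof (intro conjI allI impI assms ideal_pure_power subset_refl)
  show "f \<in> pure_power A d" if "f * g \<in> pure_power A d" "g \<notin> coord_prime A" for f g
    by (rule pure_power_primary[OF that])
  show "products_within (\<lambda>_. coord_prime A) {..<Suc (excess A d)} (pure_power A d)"
    by (rule products_within_pure_power) simp_all
qed

lemma one_notin_component: "primary_component Q A d \<Longrightarrow> 1 \<notin> Q"
  using one_notin_pure_power[of A d] primary_componentD(1,3)[of Q A d] by (metis subsetD)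

lemma component_subset_coord_prime: "primary_component Q A d \<Longrightarrow> Q \<subseteq> coord_prime A"
  using pure_power_subset_coord_prime[of A d] primary_componentD(1,3)[of Q A d] by (metis subset_trans)

lemma ideal_radical_component:
  fixes Q :: "('n::finite, 'k::field) poly_n set"
  assumes Q: "primary_component Q A d"
  shows "ideal_radical mpoly_ring Q = coord_prime A"
proof (intro subset_antisym subsetI)
  fix f :: "('n, 'k) poly_n" assume "f \<in> ideal_radical mpoly_ring Q"
  then obtain m where m: "f ^ m \<in> Q" by (auto simp: ideal_radical_def)
  show "f \<in> coord_prime A"
  proof (rule ccontr)
    assume f: "f \<notin> coord_prime A"
    from m have "1 \<in> Q"
    proof (induction m)
      case (Suc m)
      have "f ^ m * f \<in> Q" using Suc.prems by (simp add: mult.commute)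
      then have "f ^ m \<in> Q" by (rule primary_componentD(4)[OF Q _ f])
      then show ?case by (rule Suc.IH)
    qed simp
    then show False using one_notin_component[OF Q] by simp
  qed
next
  fix f :: "('n, 'k) poly_n" assume f: "f \<in> coord_prime A"
  have "(\<Prod>i<Suc (excess A d). f) \<in> Q"
    by (rule products_withinD[OF primary_componentD(5)[OF Q]]) (rule f)
  then have "f ^ Suc (excess A d) \<in> Q" by (simp only: prod_constant card_lessThan)
  then show "f \<in> ideal_radical mpoly_ring Q"
    unfolding ideal_radical_def by (auto intro!: exI[of _ "Suc (excess A d)"])
qed

text \<open>No smaller power works, since the top monomial is a product of \<open>excess A d\<close> variables of \<open>A\<close>
outside \<open>pure_power A d\<close>.\<close>

lemma noether_exponent_component:
  fixes Q :: "('n::finite, 'k::field) poly_n set"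
  assumes Q: "primary_component Q A d"
  shows "noether_exponent mpoly_ring Q = enat (Suc (excess A d))"
proof -
  have ideal: "ideal Q mpoly_ring" and sub: "Q \<subseteq> pure_power A d" and d: "\<forall>i\<in>A. 1 \<le> d i"
    and pow: "products_within (\<lambda>_. coord_prime A) {..<Suc (excess A d)} Q"
    by (rule primary_componentD[OF Q])+
  have "Suc (excess A d) \<le> m" if "products_within (\<lambda>_. coord_prime A) {..<m} Q" for m
  proof (rule ccontr)
    assume "\<not> Suc (excess A d) \<le> m"
    then have "m \<le> card (monomial_factors A d)" by (simp add: card_monomial_factors)
    then have "products_within (\<lambda>_. coord_prime A) (monomial_factors A d) Q"
      by (intro products_within_const_mono[OF ideal that]) simp_all
    then have "(\<Prod>p\<in>monomial_factors A d. variable (fst p)) \<in> Q"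
      by (rule products_withinD) (auto simp only: monomial_factors_def mem_Sigma_iff fst_conv intro!: variable_in_coord_prime)
    then have "(monomial (top_exponent A d) :: ('n, 'k) poly_n) \<in> pure_power A d"
      using sub unfolding prod_monomial_factors by blast
    moreover have "top_exponent A d \<in> keys (monomial (top_exponent A d) :: ('n, 'k) poly_n)"
      by (simp add: monomial_def)
    ultimately show False using notin_pure_power_if_top_exponent d by blast
  qed
  moreover have "ideal_radical mpoly_ring Q [^]\<^bsub>ideals_set mpoly_ring\<^esub> m \<subseteq> Q
      \<longleftrightarrow> products_within (\<lambda>_. coord_prime A) {..<m} Q" for m :: nat
    unfolding ideal_radical_component[OF Q] by (rule ideal_power_subset_iff[OF ideal ideal_pure_power])
  moreover have "Q \<noteq> carrier mpoly_ring" using one_notin_component[OF Q] by auto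
  ultimately show ?thesis
    unfolding noether_exponent_def using pow
    by (auto intro!: antisym[OF Inf_lower Inf_greatest])
qed

section \<open>Consequences of dimension one\<close>

lemma (in cring) primeideal_quot_image:
  assumes I: "ideal I R" and P: "primeideal P R" and IP: "I \<subseteq> P"
  shows "primeideal ((+>) I ` P) (R Quot I)"
    and "a \<in> carrier R \<Longrightarrow> I +> a \<in> (+>) I ` P \<longleftrightarrow> a \<in> P"
proof -
  interpret I: ideal I R by (rule I)
  interpret P: primeideal P R by (rule P)
  have mem: "I +> a \<in> (+>) I ` P \<longleftrightarrow> a \<in> P" if a: "a \<in> carrier R" for a
  proof
    assume "I +> a \<in> (+>) I ` P"
    then obtain p where p: "p \<in> P" "I +> a = I +> p" by blast
    have "a \<in> I +> p" using I.a_rcos_self[OF a] p(2) by simp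
    then obtain i where "i \<in> I" "a = i \<oplus> p" by (auto simp: a_r_coset_def')
    then show "a \<in> P" using IP p(1) by auto
  qed simp
  then show "a \<in> carrier R \<Longrightarrow> I +> a \<in> (+>) I ` P \<longleftrightarrow> a \<in> P" .
  have carrier: "carrier (R Quot I) = (+>) I ` carrier R"
    unfolding FactRing_def A_RCOSETS_def' by auto
  show "primeideal ((+>) I ` P) (R Quot I)"
  proof (rule primeidealI)
    show "ideal ((+>) I ` P) (R Quot I)"
      using ring_ideal_imp_quot_ideal[OF I P.is_ideal] .
    show "cring (R Quot I)" by (rule I.quotient_is_cring[OF is_cring])
    show "carrier (R Quot I) \<noteq> (+>) I ` P"
    proof
      assume eq: "carrier (R Quot I) = (+>) I ` P"
      have "a \<in> P" if "a \<in> carrier R" for a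
        using mem[OF that] that eq carrier by blast
      then show False using P.I_notcarr P.a_subset by blast
    qed
    fix x y assume xy: "x \<in> carrier (R Quot I)" "y \<in> carrier (R Quot I)"
      "x \<otimes>\<^bsub>R Quot I\<^esub> y \<in> (+>) I ` P"
    then obtain a b where ab: "a \<in> carrier R" "b \<in> carrier R" "x = I +> a" "y = I +> b"
      unfolding carrier by blast
    then have "I +> (a \<otimes> b) \<in> (+>) I ` P"
      using xy(3) by (simp add: FactRing_def I.rcoset_mult_add)
    then have "a \<otimes> b \<in> P" using mem ab(1,2) by simp
    then have "a \<in> P \<or> b \<in> P" by (rule P.I_prime[OF ab(1,2)])
    then show "x \<in> (+>) I ` P \<or> y \<in> (+>) I ` P" using ab by blast
  qed
qed

lemma primeideal_coord_prime: "primeideal (coord_prime A) (mpoly_ring :: ('n::finite, 'k::field) poly_n ring)"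
proof (rule primeidealI[OF ideal_pure_power cring_from_type_algebra])
  show "carrier mpoly_ring \<noteq> (coord_prime A :: ('n, 'k) poly_n set)"
    using one_notin_pure_power[of A "\<lambda>_. 1"] by auto
  fix f g :: "('n, 'k) poly_n" assume "f \<otimes>\<^bsub>mpoly_ring\<^esub> g \<in> coord_prime A"
  then show "f \<in> coord_prime A \<or> g \<in> coord_prime A" using pure_power_primary[of f g A] by auto
qed

text \<open>Two different variables outside \<open>A\<close> would give a chain of three coordinate primes above \<open>I\<close>.\<close>

lemma codim_le_one_if_krull_dim_quot:
  fixes I :: "('n::finite, 'k::field) poly_n set"
  assumes I: "ideal I mpoly_ring" "I \<subseteq> coord_prime A"
    and dim: "krull_dim (mpoly_ring Quot I) \<le> 1" and pq: "p \<notin> A" "q \<notin> A"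
  shows "p = q"
proof (rule ccontr)
  assume "p \<noteq> q"
  interpret cring "mpoly_ring :: ('n, 'k) poly_n ring" by (rule cring_from_type_algebra)
  define B where "B i = (if i = 0 then A else if i = 1 then insert p A else insert q (insert p A))"
    for i :: nat
  define P where "P i = (\<lambda>f. I +>\<^bsub>mpoly_ring\<^esub> f) ` coord_prime (B i)" for i
  have sub: "I \<subseteq> coord_prime (B i)" for i
  proof -
    have "coord_prime A \<subseteq> (coord_prime (B i) :: ('n, 'k) poly_n set)"
      unfolding coord_prime_antimono_iff by (auto simp: B_def)
    then show ?thesis using I(2) by blast
  qed
  note quot = primeideal_quot_image[OF I(1) primeideal_coord_prime sub]
  have "primeideal (P i) (mpoly_ring Quot I)" for i
    unfolding P_def by (rule quot(1))
  moreover have "P i \<subset> P (Suc i)" if "i < 2" for i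
  proof -
    have B: "B i \<subset> B (Suc i)" using pq \<open>p \<noteq> q\<close> that by (auto simp: B_def less_2_cases_iff)
    then have "coord_prime (B i) \<subseteq> (coord_prime (B (Suc i)) :: ('n, 'k) poly_n set)"
      unfolding coord_prime_antimono_iff by blast
    moreover obtain f :: "('n, 'k) poly_n" where f: "f \<in> coord_prime (B (Suc i))" "f \<notin> coord_prime (B i)"
      using B coord_prime_antimono_iff[of "B (Suc i)" "B i"] by blast
    moreover have "I +>\<^bsub>mpoly_ring\<^esub> f \<notin> P i" using f(2) quot(2) by (simp add: P_def)
    ultimately show ?thesis unfolding P_def by blast
  qed
  ultimately have "\<exists>P :: nat \<Rightarrow> ('n, 'k) poly_n set set.
      (\<forall>i\<le>2. primeideal (P i) (mpoly_ring Quot I)) \<and> (\<forall>i<2. P i \<subset> P (Suc i))"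
    by blast
  then have "enat 2 \<le> krull_dim (mpoly_ring Quot I)"
    unfolding krull_dim_def by (intro Sup_upper) blast
  then have "enat 2 \<le> 1" using dim by (rule order_trans)
  then show False by (simp add: one_enat_def)
qed

section \<open>Upper bound: few ideal factors suffice\<close>

lemma products_within_mono:
  assumes K: "ideal K (ring_of_type_algebra :: 'a::comm_ring_1 ring)"
    and "products_within J B K" "B \<subseteq> S" "finite S"
  shows "products_within J S K"
  unfolding products_within_def
proof (intro allI impI)
  fix f assume f: "\<forall>i\<in>S. f i \<in> J i"
  have "prod f B \<in> K" by (rule products_withinD[OF assms(2)]) (use f assms(3) in blast)
  then have "prod f (S - B) * prod f B \<in> K" by (rule ideal_mult_closed[OF K])
  then show "prod f S \<in> K" using prod.subset_diff[OF assms(3,4), of f] by simp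
qed

lemma products_within_antimono:
  "products_within J S K \<Longrightarrow> (\<And>i. i \<in> S \<Longrightarrow> J' i \<subseteq> J i) \<Longrightarrow> products_within J' S K"
  by (auto simp only: products_within_def subset_iff)

lemma component_cancel_prod:
  assumes Q: "primary_component Q A d" and "finite S" "\<And>i. i \<in> S \<Longrightarrow> g i \<notin> coord_prime A"
    and "f * prod g S \<in> Q"
  shows "f \<in> Q"
  using assms(2-)
proof (induction S rule: finite_induct)
  case (insert i S)
  have "(f * prod g S) * g i \<in> Q" using insert.prems(2) insert.hyps by (simp add: ac_simps)
  then have "f * prod g S \<in> Q" by (rule primary_componentD(4)[OF Q]) (intro insert.prems(1) insertI1)
  then show ?case using insert.IH insert.prems(1) by blast
qed simp

text \<open>Each of the omitted factors contains an element outside the prime ideal, which can be cancelled.\<close>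

lemma products_within_essential_factors:
  fixes J :: "'i \<Rightarrow> ('n::finite, 'k::field) poly_n set"
  assumes Q: "primary_component Q A d" and S: "finite S" and J: "products_within J S Q"
  shows "products_within J {i \<in> S. J i \<subseteq> coord_prime A} Q"
  unfolding products_within_def
proof (intro allI impI)
  let ?M = "{i \<in> S. J i \<subseteq> coord_prime A}"
  fix f assume f: "\<forall>i\<in>?M. f i \<in> J i"
  have "\<forall>i\<in>S - ?M. \<exists>x. x \<in> J i \<and> x \<notin> coord_prime A" by blast
  from bchoice[OF this]
  obtain g where g: "\<forall>i\<in>S - ?M. g i \<in> J i \<and> g i \<notin> coord_prime A" by blast
  define F where "F i = (if i \<in> ?M then f i else g i)" for i
  have "prod F S \<in> Q"
    by (rule products_withinD[OF J]) (use f g in \<open>auto simp: F_def\<close>)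
  moreover have "prod F S = prod F (S - ?M) * prod F ?M"
    by (rule prod.subset_diff) (use S in auto)
  moreover have "prod F ?M = prod f ?M" by (rule prod.cong) (auto simp: F_def)
  moreover have "prod F (S - ?M) = prod g (S - ?M)" by (rule prod.cong) (auto simp: F_def)
  ultimately have "prod f ?M * prod g (S - ?M) \<in> Q" by (simp add: mult.commute)
  then show "prod f ?M \<in> Q"
    by (rule component_cancel_prod[OF Q, rotated 2]) (use S g in auto)
qed

text \<open>Among the factors contained in the prime ideal any \<open>excess A d + 1\<close> suffice.\<close>

lemma few_factors_within_component:
  fixes J :: "'i \<Rightarrow> ('n::finite, 'k::field) poly_n set"
  assumes Q: "primary_component Q A d" and S: "finite S" and J: "products_within J S Q"
  shows "\<exists>B \<subseteq> {i \<in> S. J i \<subseteq> coord_prime A}. card B \<le> Suc (excess A d) \<and> products_within J B Q"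
proof (cases "card {i \<in> S. J i \<subseteq> coord_prime A} \<le> Suc (excess A d)")
  case True
  then show ?thesis using products_within_essential_factors[OF assms] by blast
next
  case False
  then obtain B where B: "B \<subseteq> {i \<in> S. J i \<subseteq> coord_prime A}" "card B = Suc (excess A d)" "finite B"
    by (meson obtain_subset_with_card_n nat_le_linear)
  have "products_within (\<lambda>_. coord_prime A) B Q"
    by (rule products_within_const_mono[OF primary_componentD(2,5)[OF Q] B(3)]) (simp add: B(2))
  then have "products_within J B Q" by (rule products_within_antimono) (use B(1) in blast)
  then show ?thesis using B by (intro exI[of _ B]) simp
qed

lemma few_factors_within_components:
  fixes J :: "'i \<Rightarrow> ('n::finite, 'k::field) poly_n set"
  assumes F: "finite F" "\<And>Q. Q \<in> F \<Longrightarrow> primary_component Q (A Q) (d Q)"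
    and S: "finite S" and J: "\<And>Q. Q \<in> F \<Longrightarrow> products_within J S Q"
  shows "\<exists>B \<subseteq> {i \<in> S. \<exists>Q\<in>F. J i \<subseteq> coord_prime (A Q)}.
    card B \<le> (\<Sum>Q\<in>F. Suc (excess (A Q) (d Q))) \<and> (\<forall>Q\<in>F. products_within J B Q)"
proof -
  have "\<forall>Q\<in>F. \<exists>B. B \<subseteq> {i \<in> S. J i \<subseteq> coord_prime (A Q)} \<and>
      card B \<le> Suc (excess (A Q) (d Q)) \<and> products_within J B Q"
    using few_factors_within_component[OF F(2) S J] by blast
  then obtain B where B: "\<forall>Q\<in>F. B Q \<subseteq> {i \<in> S. J i \<subseteq> coord_prime (A Q)} \<and>
      card (B Q) \<le> Suc (excess (A Q) (d Q)) \<and> products_within J (B Q) Q"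
    by (elim bchoice[THEN exE])
  let ?B = "\<Union>Q\<in>F. B Q"
  have sub: "?B \<subseteq> {i \<in> S. \<exists>Q\<in>F. J i \<subseteq> coord_prime (A Q)}" using B by blast
  then have fin: "finite ?B" using S by (auto intro: finite_subset)
  have "card ?B \<le> (\<Sum>Q\<in>F. card (B Q))" by (rule card_UN_le[OF F(1)])
  also have "\<dots> \<le> (\<Sum>Q\<in>F. Suc (excess (A Q) (d Q)))" using B by (intro sum_mono) blast
  finally have "card ?B \<le> (\<Sum>Q\<in>F. Suc (excess (A Q) (d Q)))" .
  moreover have "products_within J ?B Q" if "Q \<in> F" for Q
    by (rule products_within_mono[OF primary_componentD(2)[OF F(2)[OF that]] _ _ fin])
      (use B that in blast)+
  ultimately show ?thesis using sub by blast
qed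

lemma products_within_Inter:
  "products_within J S (\<Inter>F) \<longleftrightarrow> (\<forall>Q\<in>F. products_within J S Q)"
  by (auto simp only: products_within_def)

lemma ideal_Inter_components:
  assumes "\<And>Q. Q \<in> F \<Longrightarrow> primary_component Q (A Q) (d Q)"
  shows "ideal (\<Inter>F) mpoly_ring"
  unfolding ideal_type_algebra_iff
proof (intro conjI ballI allI InterI)
  fix Q assume Q: "Q \<in> F"
  note ideal = primary_componentD(2)[OF assms[OF Q]]
  show "0 \<in> Q" using ideal by (simp only: ideal_type_algebra_iff)
  show "x + y \<in> Q" if "x \<in> \<Inter>F" "y \<in> \<Inter>F" for x y
    using ideal_add_closed[OF ideal] that Q by blast
  show "r * x \<in> Q" if "x \<in> \<Inter>F" for x r
    using ideal_mult_closed[OF ideal] that Q by blast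
qed

lemma strongly_absorbing_Inter_components:
  fixes F :: "('n::finite, 'k::field) poly_n set set"
  assumes F: "finite F" "\<And>Q. Q \<in> F \<Longrightarrow> primary_component Q (A Q) (d Q)"
    and N: "(\<Sum>Q\<in>F. Suc (excess (A Q) (d Q))) \<le> N"
  shows "strongly_absorbing mpoly_ring N (\<Inter>F)"
proof -
  have I: "ideal (\<Inter>F) mpoly_ring" by (rule ideal_Inter_components[OF F(2)])
  show ?thesis
    unfolding strongly_absorbing_type_algebra_iff[OF I] products_within_Inter
  proof (intro allI impI)
    fix J :: "nat \<Rightarrow> ('n, 'k) poly_n set"
    assume J: "\<forall>Q\<in>F. products_within J {..N} Q"
    have "\<exists>B \<subseteq> {i \<in> {..N}. \<exists>Q\<in>F. J i \<subseteq> coord_prime (A Q)}.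
        card B \<le> (\<Sum>Q\<in>F. Suc (excess (A Q) (d Q))) \<and> (\<forall>Q\<in>F. products_within J B Q)"
      by (rule few_factors_within_components[OF F]) (use J in blast)+
    then obtain B where B: "B \<subseteq> {..N}" "card B \<le> N" "\<forall>Q\<in>F. products_within J B Q"
      using N by (blast intro: order_trans)
    have "B \<noteq> {..N}" using B(2) by auto
    then obtain j where j: "j \<le> N" "j \<notin> B" using B(1) by auto
    have "products_within J ({..N} - {j}) Q" if "Q \<in> F" for Q
      by (rule products_within_mono[OF primary_componentD(2)[OF F(2)[OF that]]])
        (use B that j in auto)
    then show "\<exists>j\<le>N. \<forall>Q\<in>F. products_within J ({..N} - {j}) Q" using j(1) by blast
  qed
qed

text \<open>The component \<open>P\<close> at the maximal ideal does not add to the number of factors: the factors chosen for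
\<open>F\<close> lie in the maximal ideal, so the choice can be enlarged to any set of \<open>N\<close> factors if all factors lie in the
maximal ideal, and to the set of all factors that do otherwise. Either choice serves \<open>P\<close> as well.\<close>

lemma strongly_absorbing_Inter_components_embedded:
  fixes F :: "('n::finite, 'k::field) poly_n set set"
  assumes F: "finite F" "\<And>Q. Q \<in> F \<Longrightarrow> primary_component Q (A Q) (d Q)"
    and P: "primary_component P UNIV c"
    and N: "(\<Sum>Q\<in>F. Suc (excess (A Q) (d Q))) \<le> N" "Suc (excess UNIV c) \<le> N"
  shows "strongly_absorbing mpoly_ring N (\<Inter>(insert P F))"
proof -
  have I: "ideal (\<Inter>(insert P F)) mpoly_ring"
    by (rule ideal_Inter_components[of _ "\<lambda>Q. if Q = P then UNIV else A Q" "\<lambda>Q. if Q = P then c else d Q"])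
      (use F(2) P in auto)
  show ?thesis
    unfolding strongly_absorbing_type_algebra_iff[OF I] products_within_Inter
  proof (intro allI impI)
    fix J :: "nat \<Rightarrow> ('n, 'k) poly_n set"
    assume J: "\<forall>Q\<in>insert P F. products_within J {..N} Q"
    define M where "M = {i \<in> {..N}. J i \<subseteq> coord_prime UNIV}"
    have "J i \<subseteq> coord_prime UNIV" if "J i \<subseteq> coord_prime (A Q)" for i Q
      using that coord_prime_antimono_iff[of "A Q" UNIV] by blast
    moreover have "\<exists>B \<subseteq> {i \<in> {..N}. \<exists>Q\<in>F. J i \<subseteq> coord_prime (A Q)}.
        card B \<le> (\<Sum>Q\<in>F. Suc (excess (A Q) (d Q))) \<and> (\<forall>Q\<in>F. products_within J B Q)"
      by (rule few_factors_within_components[OF F]) (use J in blast)+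
    then obtain B where B: "B \<subseteq> {i \<in> {..N}. \<exists>Q\<in>F. J i \<subseteq> coord_prime (A Q)}"
      "card B \<le> (\<Sum>Q\<in>F. Suc (excess (A Q) (d Q)))" "\<forall>Q\<in>F. products_within J B Q"
      by blast
    ultimately have BM: "B \<subseteq> M" unfolding M_def by blast
    have "\<exists>j\<le>N. j \<notin> B \<and> products_within J ({..N} - {j}) P"
    proof (cases "M = {..N}")
      case True
      have "B \<noteq> {..N}" using B(2) N(1) by auto
      then obtain j where j: "j \<le> N" "j \<notin> B" using BM True by auto
      have "products_within (\<lambda>_. coord_prime UNIV) ({..N} - {j}) P"
        by (rule products_within_const_mono[OF primary_componentD(2,5)[OF P]]) (use j N(2) in auto)
      then have "products_within J ({..N} - {j}) P"
        by (rule products_within_antimono) (use True in \<open>unfold M_def, blast\<close>)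
      then show ?thesis using j by blast
    next
      case False
      then obtain j where j: "j \<le> N" "j \<notin> M" unfolding M_def by auto
      have "products_within J M P"
        unfolding M_def by (rule products_within_essential_factors[OF P]) (use J in auto)
      then have "products_within J ({..N} - {j}) P"
        by (rule products_within_mono[OF primary_componentD(2)[OF P]]) (use j in \<open>auto simp: M_def\<close>)
      then show ?thesis using j BM by blast
    qed
    then obtain j where j: "j \<le> N" "j \<notin> B" "products_within J ({..N} - {j}) P" by blast
    have "products_within J ({..N} - {j}) Q" if "Q \<in> F" for Q
      by (rule products_within_mono[OF primary_componentD(2)[OF F(2)[OF that]]])
        (use B that j in auto)
    then show "\<exists>j\<le>N. \<forall>Q\<in>insert P F. products_within J ({..N} - {j}) Q" using j by blast
  qed
qed

section \<open>Lower bounds: critical products\<close>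

text \<open>One index for each variable in the top monomial, with multiplicity, and the additional index
\<open>None\<close> for the sum of all variables in \<open>A\<close>.\<close>

definition critical_indices :: "'n set \<Rightarrow> ('n \<Rightarrow> nat) \<Rightarrow> ('n \<times> nat) option set" where
  "critical_indices A d = insert None (Some ` monomial_factors A d)"

text \<open>The summand \<open>h\<close> is meant to have only terms of degree at least two: it is \<open>0\<close>, or it moves the
factor out of other coordinate primes without changing its lowest term.\<close>

definition critical_factor ::
    "'n set \<Rightarrow> ('n::finite, 'k::field) poly_n \<Rightarrow> ('n \<times> nat) option \<Rightarrow> ('n, 'k) poly_n" where
  "critical_factor A h p = (case p of None \<Rightarrow> (\<Sum>l\<in>A. variable l) | Some (i, c) \<Rightarrow> variable i + h)"

lemma finite_critical_indices [simp]: "finite (critical_indices A d)" for A :: "'n::finite set"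
  by (simp add: critical_indices_def)

lemma card_critical_indices: "card (critical_indices A d) = Suc (excess A d)" for A :: "'n::finite set"
  by (simp add: critical_indices_def card_image card_monomial_factors)

lemma lookup_variable: "lookup (variable l :: ('n::finite, 'k::field) poly_n) a = (if a = single l 1 then 1 else 0)"
  by (auto simp: variable_def monomial_def lookup_single when_def)

lemma single_one_eq_iff: "single l (1::nat) = single m 1 \<longleftrightarrow> l = m"
  by (metis keys_single singleton_inject zero_neq_one)

lemma lookup_sum_variables:
  "lookup (\<Sum>l\<in>A. variable l :: ('n::finite, 'k::field) poly_n) (single m 1) = (if m \<in> A then 1 else 0)"
  unfolding lookup_sum lookup_variable single_one_eq_iff by (simp add: sum.delta')

lemma keys_sum_variables:
  "keys (\<Sum>l\<in>A. variable l :: ('n::finite, 'k::field) poly_n) \<subseteq> (\<lambda>l. single l 1) ` A"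
proof
  fix a assume "a \<in> keys (\<Sum>l\<in>A. variable l :: ('n, 'k) poly_n)"
  then have "a \<in> (\<Union>l\<in>A. keys (variable l :: ('n, 'k) poly_n))" using keys_sum by fast
  then show "a \<in> (\<lambda>l. single l 1) ` A" by (auto simp: variable_def monomial_def)
qed

text \<open>In this weight the variable \<open>m\<close> is smaller than all others, and all variables are smaller than all
monomials of degree at least two.\<close>

definition favouring_weight :: "'n::finite \<Rightarrow> ('n \<Rightarrow>\<^sub>0 nat) \<Rightarrow> nat" where
  "favouring_weight m a = (\<Sum>i\<in>UNIV. (if i = m then 2 else 3) * lookup a i)"

lemma favouring_weight_add:
  "favouring_weight m (a + b) = favouring_weight m a + favouring_weight m b"
  by (simp add: favouring_weight_def lookup_add sum.distrib algebra_simps)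

lemma favouring_weight_single: "favouring_weight m (single i 1) = (if i = m then 2 else 3)"
proof -
  have "favouring_weight m (single i 1) = (\<Sum>j\<in>UNIV. if j = i then if i = m then 2 else 3 else 0)"
    unfolding favouring_weight_def by (intro sum.cong) (auto simp: lookup_single when_def)
  then show ?thesis by simp
qed

lemma favouring_weight_ge: "2 * (\<Sum>i\<in>UNIV. lookup a i) \<le> favouring_weight m a"
  unfolding favouring_weight_def sum_distrib_left by (intro sum_mono) auto

lemma degree_single: "(\<Sum>j\<in>UNIV. lookup (single (i::'n::finite) m) j) = (m::nat)"
  by (simp add: lookup_single when_def)

lemma leading_variable_plus_higher:
  fixes h :: "('n::finite, 'k::field) poly_n"
  assumes h: "\<forall>a\<in>keys h. 2 \<le> (\<Sum>i\<in>UNIV. lookup a i)"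
  shows "leading (favouring_weight m) (variable i + h) (single i 1)"
  unfolding leading_def
proof (intro conjI ballI impI)
  have "single i 1 \<notin> keys h" using h degree_single[of i 1] by force
  then show "single i 1 \<in> keys (variable i + h)"
    by (simp add: in_keys_iff lookup_add lookup_variable)
  fix b assume b: "b \<in> keys (variable i + h)" "b \<noteq> single i 1"
  then have "b \<in> keys h" by (simp add: in_keys_iff lookup_add lookup_variable)
  then have "2 \<le> (\<Sum>i\<in>UNIV. lookup b i)" using h by blast
  then have "4 \<le> favouring_weight m b" using favouring_weight_ge[of b m] by linarith
  then show "favouring_weight m (single i 1) < favouring_weight m b"
    unfolding favouring_weight_single by simp
qed

lemma leading_sum_variables:
  assumes "m \<in> A"
  shows "leading (favouring_weight m) (\<Sum>l\<in>A. variable l :: ('n::finite, 'k::field) poly_n) (single m 1)"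
  unfolding leading_def
proof (intro conjI ballI impI)
  show "single m 1 \<in> keys (\<Sum>l\<in>A. variable l :: ('n, 'k) poly_n)"
    using assms lookup_sum_variables[where A = A and m = m and 'k = 'k] by (simp add: in_keys_iff)
  fix b assume b: "b \<in> keys (\<Sum>l\<in>A. variable l :: ('n, 'k) poly_n)" "b \<noteq> single m 1"
  then obtain l where "b = single l 1" using keys_sum_variables by fast
  moreover have "l \<noteq> m" using b(2) calculation by blast
  ultimately show "favouring_weight m (single m 1) < favouring_weight m b"
    by (simp only: favouring_weight_single) simp
qed

text \<open>If the omitted factor belongs to the variable \<open>m\<close>, choose the weight in which \<open>m\<close> is the smallest
variable: then the factor \<open>\<Sum>x\<^sub>l\<close> has the leading term \<open>x\<^sub>m\<close> and makes up for the omission, and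
the leading term of the product is the top monomial. If the factor \<open>\<Sum>x\<^sub>l\<close> is omitted, any such weight
will do.\<close>

lemma top_exponent_in_critical_subproduct:
  fixes h :: "('n::finite, 'k::field) poly_n"
  assumes h: "\<forall>a\<in>keys h. 2 \<le> (\<Sum>i\<in>UNIV. lookup a i)" and p: "p \<in> critical_indices A d"
  shows "top_exponent A d \<in> keys (prod (critical_factor A h) (critical_indices A d - {p}))"
proof -
  let ?K = "Some ` monomial_factors A d" and ?e = "\<lambda>q :: ('n \<times> nat) option. single (fst (the q)) (1::nat)"
  have lead: "leading (favouring_weight m) (critical_factor A h q) (?e q)" if "q \<in> ?K" for q m
    using that leading_variable_plus_higher[OF h] by (auto simp: critical_factor_def)
  have top: "sum ?e ?K = top_exponent A d"
    by (simp add: sum.reindex sum_monomial_factors[simplified])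
  show ?thesis
  proof (cases p)
    case None
    then have K: "critical_indices A d - {p} = ?K" by (auto simp: critical_indices_def)
    have "leading (favouring_weight undefined) (prod (critical_factor A h) ?K) (sum ?e ?K)"
      by (rule leading_prod[OF favouring_weight_add]) (simp, rule lead)
    then show ?thesis unfolding K top by (simp add: leading_def)
  next
    case (Some ic)
    then have ic: "p \<in> ?K" "fst ic \<in> A"
      using p by (auto simp: critical_indices_def monomial_factors_def)
    have K: "critical_indices A d - {p} = insert None (?K - {p})"
      using Some by (auto simp: critical_indices_def)
    have "leading (favouring_weight (fst ic)) (prod (critical_factor A h) (?K - {p})) (sum ?e (?K - {p}))"
      by (rule leading_prod[OF favouring_weight_add]) (simp, rule lead, blast)
    moreover have "leading (favouring_weight (fst ic)) (critical_factor A h None) (?e p)"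
      using leading_sum_variables[OF ic(2)] Some by (simp add: critical_factor_def)
    ultimately have "leading (favouring_weight (fst ic))
        (critical_factor A h None * prod (critical_factor A h) (?K - {p})) (?e p + sum ?e (?K - {p}))"
      by (intro leading_mult[OF favouring_weight_add])
    moreover have "?e p + sum ?e (?K - {p}) = top_exponent A d"
      using sum.remove[OF _ ic(1), of ?e] top by simp
    moreover have "critical_factor A h None * prod (critical_factor A h) (?K - {p})
        = prod (critical_factor A h) (critical_indices A d - {p})"
      unfolding K by (subst prod.insert) auto
    ultimately show ?thesis by (simp add: leading_def)
  qed
qed

lemma critical_factor_in_coord_prime:
  assumes "h \<in> coord_prime A" "p \<in> critical_indices A d"
  shows "critical_factor A h p \<in> coord_prime A"
proof (cases p)
  case None
  have "(\<Sum>l\<in>A. variable l) \<in> coord_prime A"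
    by (rule ideal_sum_closed[OF ideal_pure_power]) (rule variable_in_coord_prime)
  then show ?thesis by (simp add: None critical_factor_def)
next
  case (Some ic)
  then have "fst ic \<in> A" using assms(2) by (auto simp: critical_indices_def monomial_factors_def)
  then have "variable (fst ic) + h \<in> coord_prime A"
    by (intro ideal_add_closed[OF ideal_pure_power] variable_in_coord_prime assms(1))
  then show ?thesis by (simp add: Some critical_factor_def case_prod_beta)
qed

text \<open>This polynomial lies in the coordinate prime of \<open>A\<close> but in no coordinate prime that lacks a variable
of \<open>A\<close>. Adding a variable of \<open>A\<close> to it does not change this.\<close>

definition square_sum :: "'n set \<Rightarrow> ('n::finite, 'k::field) poly_n" where
  "square_sum A = (\<Sum>l\<in>A. monomial (single l 2))"

lemma keys_square_sum: "keys (square_sum A :: ('n::finite, 'k::field) poly_n) \<subseteq> (\<lambda>l. single l 2) ` A"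
proof
  fix a assume "a \<in> keys (square_sum A :: ('n, 'k) poly_n)"
  then have "a \<in> (\<Union>l\<in>A. keys (monomial (single l 2) :: ('n, 'k) poly_n))"
    using keys_sum unfolding square_sum_def by fast
  then show "a \<in> (\<lambda>l. single l 2) ` A" by (auto simp: monomial_def)
qed

lemma square_sum_degree:
  "\<forall>a\<in>keys (square_sum A :: ('n::finite, 'k::field) poly_n). 2 \<le> (\<Sum>i\<in>UNIV. lookup a i)"
proof
  fix a assume "a \<in> keys (square_sum A :: ('n, 'k) poly_n)"
  then obtain l where "a = single l 2" using keys_square_sum by fast
  then show "2 \<le> (\<Sum>i\<in>UNIV. lookup a i)" by (simp only: degree_single)
qed

lemma square_sum_in_coord_prime: "square_sum A \<in> (coord_prime A :: ('n::finite, 'k::field) poly_n set)"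
  unfolding pure_power_def
proof (intro CollectI ballI)
  fix a assume "a \<in> keys (square_sum A :: ('n, 'k) poly_n)"
  then obtain l where "l \<in> A" "a = single l 2" using keys_square_sum by fast
  then show "\<exists>i\<in>A. 1 \<le> lookup a i" by (intro bexI[of _ l]) simp_all
qed

lemma lookup_square_sum:
  "l \<in> A \<Longrightarrow> lookup (square_sum A :: ('n::finite, 'k::field) poly_n) (single l 2) = 1"
proof -
  assume l: "l \<in> A"
  have eq: "single i (2::nat) = single l 2 \<longleftrightarrow> i = l" for i :: 'n
    by (metis keys_single singleton_inject zero_neq_numeral)
  show ?thesis
    using l unfolding square_sum_def lookup_sum monomial_def lookup_single when_def eq
    by (simp add: sum.delta)
qed

lemma critical_factor_notin_coord_prime:
  assumes l: "l \<in> A" "l \<notin> B"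
  shows "critical_factor A (square_sum A) p \<notin> (coord_prime B :: ('n::finite, 'k::field) poly_n set)"
proof -
  have "\<exists>m. single l m \<in> keys (critical_factor A (square_sum A) p :: ('n, 'k) poly_n)"
  proof (cases p)
    case None
    have "single l 1 \<in> keys (\<Sum>l\<in>A. variable l :: ('n, 'k) poly_n)"
      using lookup_sum_variables[where A = A and m = l and 'k = 'k] l(1) by (simp add: in_keys_iff)
    then show ?thesis unfolding None critical_factor_def by auto
  next
    case (Some ic)
    have "single l 2 \<noteq> single (fst ic) (1::nat)"
      by (metis degree_single numeral_eq_one_iff semiring_norm(85))
    then have "single l 2 \<in> keys (variable (fst ic) + square_sum A :: ('n, 'k) poly_n)"
      using lookup_square_sum[OF l(1), where 'k = 'k]
      by (simp add: in_keys_iff lookup_add lookup_variable)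
    then show ?thesis unfolding Some critical_factor_def by (auto simp: case_prod_beta)
  qed
  then obtain m where m: "single l m \<in> keys (critical_factor A (square_sum A) p :: ('n, 'k) poly_n)" ..
  show ?thesis
  proof
    assume "critical_factor A (square_sum A) p \<in> (coord_prime B :: ('n, 'k) poly_n set)"
    then obtain i where "i \<in> B" "1 \<le> lookup (single l m) i"
      using m unfolding pure_power_def by blast
    then show False using l(2) by (auto simp: lookup_single when_def split: if_splits)
  qed
qed

text \<open>The critical factors of all components form one critical product: those of another component are not
in the prime ideal of the component at hand and can be cancelled, so that an omission is detected by that
component alone. The ideal \<open>L\<close> is the component at the maximal ideal, whose membership is automatic when
there are enough factors, or the whole ring if there is no such component.\<close>

lemma not_absorbing_if_incomparable_components:
  fixes F :: "('n::finite, 'k::field) poly_n set set"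
  assumes F: "finite F" "\<And>Q. Q \<in> F \<Longrightarrow> primary_component Q (A Q) (d Q)"
    and incomparable: "\<And>Q Q'. Q \<in> F \<Longrightarrow> Q' \<in> F \<Longrightarrow> Q \<noteq> Q' \<Longrightarrow> \<not> A Q \<subseteq> A Q'"
    and I: "ideal I mpoly_ring" "\<And>Q. Q \<in> F \<Longrightarrow> I \<subseteq> Q"
    and L: "ideal L mpoly_ring"
      "products_within (\<lambda>_. coord_prime UNIV) {..<\<Sum>Q\<in>F. Suc (excess (A Q) (d Q))} L"
      "\<Inter>F \<inter> L \<subseteq> I"
    and N: "N < (\<Sum>Q\<in>F. Suc (excess (A Q) (d Q)))"
  shows "\<not> absorbing mpoly_ring N I"
proof -
  define K where "K = (SIGMA Q:F. critical_indices (A Q) (d Q))"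
  define g where "g = (\<lambda>(Q, p). critical_factor (A Q) (square_sum (A Q)) p :: ('n, 'k) poly_n)"
  have finK: "finite K" unfolding K_def using F(1) by auto
  have cardK: "card K = (\<Sum>Q\<in>F. Suc (excess (A Q) (d Q)))"
    unfolding K_def using F(1) by (simp add: card_critical_indices)
  have slice: "prod g ({Q} \<times> S) = prod (critical_factor (A Q) (square_sum (A Q))) S" for Q S
    by (subst prod.cartesian_product[symmetric, of "\<lambda>Q p. g (Q, p)", simplified])
      (simp add: g_def)
  have in_prime: "g x \<in> coord_prime (A (fst x))" if x: "x \<in> K" for x
  proof -
    obtain Q p where Qp: "x = (Q, p)" by (cases x)
    have "p \<in> critical_indices (A Q) (d Q)" using x by (simp add: Qp K_def)
    then show ?thesis unfolding Qp g_def prod.case fst_conv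
      by (rule critical_factor_in_coord_prime[OF square_sum_in_coord_prime])
  qed
  have in_Q: "prod g K \<in> Q" if Q: "Q \<in> F" for Q
  proof -
    let ?S = "{Q} \<times> critical_indices (A Q) (d Q)"
    have ideal: "ideal Q mpoly_ring" by (rule primary_componentD(2)[OF F(2)[OF Q]])
    have "products_within (\<lambda>_. coord_prime (A Q)) ?S Q"
      by (rule products_within_const_mono[OF ideal primary_componentD(5)[OF F(2)[OF Q]]])
        (simp_all add: card_cartesian_product card_critical_indices)
    then have "prod g ?S \<in> Q"
    proof (rule products_withinD)
      fix x assume x: "x \<in> ?S"
      then have "x \<in> K" "fst x = Q" using Q by (auto simp: K_def)
      then show "g x \<in> coord_prime (A Q)" using in_prime by blast
    qed
    then have "prod g (K - ?S) * prod g ?S \<in> Q" by (rule ideal_mult_closed[OF ideal])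
    moreover have "?S \<subseteq> K" using Q by (auto simp: K_def)
    ultimately show ?thesis using prod.subset_diff[OF _ finK, of ?S g] by simp
  qed
  have in_L: "prod g K \<in> L"
  proof (rule products_withinD[OF products_within_const_mono[OF L(1,2) finK]])
    fix x assume "x \<in> K"
    then show "g x \<in> coord_prime UNIV"
      using in_prime coord_prime_antimono_iff[of "A (fst x)" UNIV] by blast
  qed (simp add: cardK)
  have "prod g K \<in> I" using in_Q in_L L(3) by blast
  then show ?thesis
  proof (rule not_absorbing_if_critical_product[OF I(1) finK N[folded cardK]])
    fix x assume x: "x \<in> K"
    obtain Q p where Qp: "x = (Q, p)" by (cases x)
    have Q: "Q \<in> F" and p: "p \<in> critical_indices (A Q) (d Q)" using x by (auto simp: Qp K_def)
    let ?S = "{Q} \<times> (critical_indices (A Q) (d Q) - {p})" and ?R = "{y \<in> K. fst y \<noteq> Q}"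
    have split: "K - {x} = ?S \<union> ?R" using Q by (auto simp: K_def Qp)
    have "prod g (K - {x}) = prod g ?S * prod g ?R"
      unfolding split by (rule prod.union_disjoint) (use finK in auto)
    moreover have "g y \<notin> coord_prime (A Q)" if y: "y \<in> ?R" for y
    proof -
      obtain Q' q where y': "y = (Q', q)" by (cases y)
      have "Q' \<in> F" "Q' \<noteq> Q" using y by (auto simp: y' K_def)
      then obtain l where "l \<in> A Q'" "l \<notin> A Q" using incomparable Q by blast
      then show ?thesis unfolding y' g_def prod.case by (rule critical_factor_notin_coord_prime)
    qed
    moreover have "prod g ?S \<notin> Q"
    proof -
      have "prod g ?S \<notin> pure_power (A Q) (d Q)"
        unfolding slice
        by (rule notin_pure_power_if_top_exponent[OF primary_componentD(1)[OF F(2)[OF Q]]])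
          (rule top_exponent_in_critical_subproduct[OF square_sum_degree p])
      then show ?thesis using primary_componentD(3)[OF F(2)[OF Q]] by blast
    qed
    ultimately have "prod g (K - {x}) \<notin> Q"
      using component_cancel_prod[OF F(2)[OF Q], of ?R g "prod g ?S"] finK by auto
    then show "prod g (K - {x}) \<notin> I" using I(2)[OF Q] by blast
  qed
qed

text \<open>The variables of the top monomial and the sum of all variables of \<open>A\<close> form a critical product.\<close>

lemma not_absorbing_if_top_monomial_socle:
  fixes I :: "('n::finite, 'k::field) poly_n set"
  assumes I: "ideal I mpoly_ring" "I \<subseteq> pure_power A d" and d: "\<forall>i\<in>A. 1 \<le> d i"
    and socle: "\<And>i. i \<in> A \<Longrightarrow> monomial (top_exponent A d) * variable i \<in> I"
    and N: "N < Suc (excess A d)"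
  shows "\<not> absorbing mpoly_ring N I"
proof (rule not_absorbing_if_critical_product[OF I(1) finite_critical_indices N[folded card_critical_indices]])
  let ?g = "critical_factor A (0 :: ('n, 'k) poly_n)"
  have "prod ?g (critical_indices A d) = ?g None * prod ?g (Some ` monomial_factors A d)"
    unfolding critical_indices_def by (subst prod.insert) auto
  also have "prod ?g (Some ` monomial_factors A d) = monomial (top_exponent A d)"
    by (simp add: prod.reindex critical_factor_def case_prod_beta prod_monomial_factors)
  also have "?g None * monomial (top_exponent A d) = (\<Sum>i\<in>A. monomial (top_exponent A d) * variable i)"
    by (simp add: critical_factor_def sum_distrib_right mult.commute)
  also have "\<dots> \<in> I" by (rule ideal_sum_closed[OF I(1)]) (rule socle)
  finally show "prod ?g (critical_indices A d) \<in> I" .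
  fix p assume "p \<in> critical_indices A d"
  then have "top_exponent A d \<in> keys (prod ?g (critical_indices A d - {p}))"
    by (intro top_exponent_in_critical_subproduct) simp_all
  then show "prod ?g (critical_indices A d - {p}) \<notin> I"
    using notin_pure_power_if_top_exponent[OF d] I(2) by blast
qed

section \<open>The canonical decomposition\<close>

text \<open>The members of a class are generated by powers of the same variables, as the radical determines these. The
member with the largest excess is the one that decides which powers of the radical lie in the
intersection.\<close>

lemma canonical_component_exists:
  fixes \<T> :: "('n::finite, 'k::field) poly_n set set"
  assumes fin: "finite \<T>" and pp: "\<forall>T\<in>\<T>. pure_power_ideal T" and T: "T \<in> \<T>"
  defines "Q \<equiv> \<Inter>{T' \<in> \<T>. ideal_radical mpoly_ring T' = ideal_radical mpoly_ring T}"
  shows "\<exists>A d. primary_component Q A d \<and> pure_power A d \<in> \<T> \<and>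
    Q = \<Inter>{T' \<in> \<T>. ideal_radical mpoly_ring T' = coord_prime A}"
proof -
  obtain A d0 where A: "\<forall>i\<in>A. 1 \<le> d0 i" "T = pure_power A d0"
    using pp T unfolding pure_power_ideal_iff by blast
  have rad: "ideal_radical mpoly_ring T = coord_prime A"
    unfolding A(2) by (rule ideal_radical_component[OF primary_component_pure_power[OF A(1)]])
  define C where "C = {T' \<in> \<T>. ideal_radical mpoly_ring T' = coord_prime A}"
  have Q: "Q = \<Inter>C" unfolding Q_def C_def rad ..
  have C: "finite C" "T \<in> C" using fin T rad by (auto simp: C_def)
  have "\<forall>T'\<in>C. \<exists>d. (\<forall>i\<in>A. 1 \<le> d i) \<and> T' = pure_power A d"
  proof
    fix T' assume "T' \<in> C"
    then have T': "T' \<in> \<T>" "ideal_radical mpoly_ring T' = coord_prime A" by (auto simp: C_def)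
    obtain A' d where A': "\<forall>i\<in>A'. 1 \<le> d i" "T' = pure_power A' d"
      using pp T'(1) unfolding pure_power_ideal_iff by blast
    have "coord_prime A' = (coord_prime A :: ('n, 'k) poly_n set)"
      using T'(2) unfolding A'(2) ideal_radical_component[OF primary_component_pure_power[OF A'(1)]] .
    then have "coord_prime A' \<subseteq> (coord_prime A :: ('n, 'k) poly_n set)"
      "coord_prime A \<subseteq> (coord_prime A' :: ('n, 'k) poly_n set)"
      by simp_all
    then have "A' = A" unfolding coord_prime_antimono_iff by (rule subset_antisym)
    then show "\<exists>d. (\<forall>i\<in>A. 1 \<le> d i) \<and> T' = pure_power A d" using A' by blast
  qed
  from bchoice[OF this] obtain d where d: "\<forall>T'\<in>C. (\<forall>i\<in>A. 1 \<le> d T' i) \<and> T' = pure_power A (d T')"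
    by blast
  have "Max ((\<lambda>T'. excess A (d T')) ` C) \<in> (\<lambda>T'. excess A (d T')) ` C"
    by (rule Max_in) (use C in auto)
  then obtain M where M: "M \<in> C" "excess A (d M) = Max ((\<lambda>T'. excess A (d T')) ` C)" by auto
  have max: "excess A (d T') \<le> excess A (d M)" if "T' \<in> C" for T'
    unfolding M(2) using that C(1) by (intro Max_ge) auto
  have comp: "primary_component T' A (d T')" if "T' \<in> C" for T'
  proof -
    have "\<forall>i\<in>A. 1 \<le> d T' i" and eq: "T' = pure_power A (d T')" using d that by blast+
    then show ?thesis by (subst eq) (intro primary_component_pure_power)
  qed
  have "primary_component Q A (d M)"
    unfolding primary_component_def
  proof (intro conjI allI impI)
    show "\<forall>i\<in>A. 1 \<le> d M i" using d M(1) by blast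
    show "ideal Q mpoly_ring" unfolding Q by (rule ideal_Inter_components[OF comp])
    show "Q \<subseteq> pure_power A (d M)" using d M(1) unfolding Q by blast
    show "f \<in> Q" if "f * g \<in> Q" "g \<notin> coord_prime A" for f g
      unfolding Q
    proof (rule InterI)
      fix T' assume T': "T' \<in> C"
      then have "f * g \<in> T'" using that(1) unfolding Q by blast
      then show "f \<in> T'" by (rule primary_componentD(4)[OF comp[OF T']]) (rule that(2))
    qed
    show "products_within (\<lambda>_. coord_prime A) {..<Suc (excess A (d M))} Q"
      unfolding Q products_within_Inter
    proof
      fix T' assume T': "T' \<in> C"
      then have "T' = pure_power A (d T')" using d by blast
      moreover have "products_within (\<lambda>_. coord_prime A) {..<Suc (excess A (d M))}
          (pure_power A (d T') :: ('n, 'k) poly_n set)"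
        by (rule products_within_pure_power) (use max[OF T'] in auto)
      ultimately show "products_within (\<lambda>_. coord_prime A) {..<Suc (excess A (d M))} T'" by simp
    qed
  qed
  moreover have "pure_power A (d M) \<in> \<T>" using d M(1) C_def by auto
  ultimately show ?thesis using Q C_def by blast
qed

text \<open>By irredundancy another member \<open>(x\<^sub>i^d'\<^sub>i | i \<in> A')\<close> is not contained in \<open>(x\<^sub>i^d\<^sub>i)\<close>, so
\<open>d'\<^sub>i \<le> d\<^sub>i - 1\<close> for some \<open>i \<in> A'\<close>, and the top monomial lies in it. In \<open>(x\<^sub>i^d\<^sub>i)\<close>
itself it is multiplied into the ideal by each variable.\<close>

lemma top_monomial_socle_if_irredundant:
  fixes I :: "('n::finite, 'k::field) poly_n set"
  assumes \<T>: "standard_decomposition I \<T>" and T: "pure_power UNIV d \<in> \<T>" and d: "\<forall>i. 1 \<le> d i"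
  shows "monomial (top_exponent UNIV d) * variable i \<in> I"
proof -
  let ?T = "pure_power UNIV d :: ('n, 'k) poly_n set" and ?w = "top_exponent UNIV d"
  have "(monomial ?w * variable i :: ('n, 'k) poly_n) \<in> T'" if T': "T' \<in> \<T>" for T'
  proof (cases "T' = ?T")
    case True
    have "\<exists>j\<in>UNIV. d j \<le> lookup (?w + single i 1) j"
      by (intro bexI[of _ i]) (simp_all add: lookup_add lookup_top_exponent)
    then show ?thesis
      unfolding True pure_power_def by (simp add: monomial_def variable_def mult_single)
  next
    case False
    have "pure_power_ideal T'" using \<T> T' by (simp add: standard_decomposition_def)
    then obtain A' d' where A': "T' = pure_power A' d'" unfolding pure_power_ideal_iff by blast
    have "\<not> T' \<subseteq> ?T"
    proof
      assume "T' \<subseteq> ?T"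
      moreover have "\<Inter>(\<T> - {?T}) \<subseteq> T'" using T' False by (intro Inter_lower) simp
      ultimately have "\<Inter>(\<T> - {?T}) = \<Inter>(insert ?T (\<T> - {?T}))" by auto
      also have "insert ?T (\<T> - {?T}) = \<T>" using T by (rule insert_Diff)
      finally show False using \<T> T unfolding standard_decomposition_def by metis
    qed
    then obtain f where f: "f \<in> T'" "f \<notin> ?T" by blast
    then obtain a where a: "a \<in> keys f" "\<forall>j. \<not> d j \<le> lookup a j" unfolding pure_power_def by blast
    then obtain j where j: "j \<in> A'" "d' j \<le> lookup a j"
      using f(1) unfolding A' pure_power_def by blast
    have "lookup a j < d j" using a(2) by (simp add: not_le)
    then have "d' j \<le> lookup ?w j" using j(2) by (simp add: lookup_top_exponent)
    then have "(monomial ?w :: ('n, 'k) poly_n) \<in> T'"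
      using j(1) unfolding A' pure_power_def by (auto simp: monomial_def)
    then have "variable i * monomial ?w \<in> T'"
      unfolding A' by (rule ideal_mult_closed[OF ideal_pure_power])
    then show ?thesis by (simp add: mult.commute)
  qed
  then have "monomial ?w * variable i \<in> \<Inter>\<T>" by (rule InterI)
  then show ?thesis using \<T> by (simp add: standard_decomposition_def)
qed

lemma sum_enat: "(\<Sum>q\<in>F. enat (f q)) = enat (\<Sum>q\<in>F. f q)"
  by (induction F rule: infinite_finite_induct) (simp_all add: zero_enat_def)

lemma sum_noether_exponent:
  assumes "\<And>Q. Q \<in> F \<Longrightarrow> primary_component Q (A Q) (d Q)"
  shows "(\<Sum>Q\<in>F. noether_exponent mpoly_ring Q) = enat (\<Sum>Q\<in>F. Suc (excess (A Q) (d Q)))"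
proof -
  have "(\<Sum>Q\<in>F. noether_exponent mpoly_ring Q) = (\<Sum>Q\<in>F. enat (Suc (excess (A Q) (d Q))))"
    by (rule sum.cong[OF refl]) (rule noether_exponent_component[OF assms])
  then show ?thesis by (simp only: sum_enat)
qed

theorem corollary5:
  fixes I :: "('n::finite, 'k::field) poly_n set"
    and \<Q> :: "('n, 'k) poly_n set set"
  assumes "monomial_ideal I"
    and "krull_dim (mpoly_ring Quot I) = 1"
    and "canonical_primary_decomposition I \<Q>"
  shows "omega mpoly_ring I = strong_omega mpoly_ring I \<and>
    (\<forall>Q\<in>\<Q>. ideal_radical mpoly_ring Q = variables_ideal \<longrightarrow>
       omega mpoly_ring I =
         max (noether_exponent mpoly_ring Q) (\<Sum>Q'\<in>\<Q> - {Q}. noether_exponent mpoly_ring Q')) \<and>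
    ((\<forall>Q\<in>\<Q>. ideal_radical mpoly_ring Q \<noteq> variables_ideal) \<longrightarrow>
       omega mpoly_ring I = (\<Sum>Q\<in>\<Q>. noether_exponent mpoly_ring Q))"
proof -
  from assms(3) obtain \<T> where \<T>: "standard_decomposition I \<T>"
    and \<Q>: "\<Q> = Inter ` (\<T> // {(T, T'). T \<in> \<T> \<and> T' \<in> \<T> \<and>
      ideal_radical mpoly_ring T = ideal_radical mpoly_ring T'})"
    unfolding canonical_primary_decomposition_def by blast
  have fin\<T>: "finite \<T>" and pp: "\<forall>T\<in>\<T>. pure_power_ideal T" and I\<T>: "I = \<Inter>\<T>"
    using \<T> by (simp_all add: standard_decomposition_def)
  define cls where "cls T = {T' \<in> \<T>. ideal_radical mpoly_ring T' = ideal_radical mpoly_ring T}" for T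
  have \<Q>': "\<Q> = (\<lambda>T. \<Inter>(cls T)) ` \<T>"
  proof -
    have "{(T, T'). T \<in> \<T> \<and> T' \<in> \<T> \<and> ideal_radical mpoly_ring T = ideal_radical mpoly_ring T'} `` {T}
        = cls T" if "T \<in> \<T>" for T
      using that by (auto simp: cls_def)
    then show ?thesis unfolding \<Q> quotient_def by auto
  qed
  have fin\<Q>: "finite \<Q>" unfolding \<Q>' using fin\<T> by simp
  have I\<Q>: "I = \<Inter>\<Q>"
  proof -
    have "T \<in> cls T" "cls T \<subseteq> \<T>" if "T \<in> \<T>" for T using that by (auto simp: cls_def)
    then show ?thesis unfolding I\<T> \<Q>' by blast
  qed
  have "\<forall>Q\<in>\<Q>. \<exists>Ad. primary_component Q (fst Ad) (snd Ad) \<and> pure_power (fst Ad) (snd Ad) \<in> \<T> \<and>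
    Q = \<Inter>{T' \<in> \<T>. ideal_radical mpoly_ring T' = coord_prime (fst Ad)}"
    unfolding \<Q>' cls_def using canonical_component_exists[OF fin\<T> pp] by simp
  from bchoice[OF this] obtain Ad where Ad: "\<forall>Q\<in>\<Q>. primary_component Q (fst (Ad Q)) (snd (Ad Q)) \<and>
    pure_power (fst (Ad Q)) (snd (Ad Q)) \<in> \<T> \<and>
    Q = \<Inter>{T' \<in> \<T>. ideal_radical mpoly_ring T' = coord_prime (fst (Ad Q))}"
    ..
  define A d where "A Q = fst (Ad Q)" and "d Q = snd (Ad Q)" for Q
  note Ad = Ad[folded A_def d_def, THEN bspec]
  have comp: "primary_component Q (A Q) (d Q)" if "Q \<in> \<Q>" for Q
    by (rule conjunct1[OF Ad[OF that]])
  have mem: "pure_power (A Q) (d Q) \<in> \<T>" if "Q \<in> \<Q>" for Q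
    by (rule conjunct1[OF conjunct2[OF Ad[OF that]]])
  have meet: "Q = \<Inter>{T' \<in> \<T>. ideal_radical mpoly_ring T' = coord_prime (A Q)}" if "Q \<in> \<Q>" for Q
    by (rule conjunct2[OF conjunct2[OF Ad[OF that]]])
  have inj: "Q = Q'" if "Q \<in> \<Q>" "Q' \<in> \<Q>" "A Q = A Q'" for Q Q'
    by (subst meet[OF that(1)], subst meet[OF that(2)]) (simp only: that(3))
  have ideal: "ideal I mpoly_ring"
    unfolding I\<Q> by (rule ideal_Inter_components[OF comp])
  have sub: "I \<subseteq> Q" if "Q \<in> \<Q>" for Q unfolding I\<Q> using that by blast
  have codim: "p = q" if "Q \<in> \<Q>" "p \<notin> A Q" "q \<notin> A Q" for Q p q
  proof (rule codim_le_one_if_krull_dim_quot[OF ideal _ _ that(2,3)])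
    show "I \<subseteq> coord_prime (A Q)"
      using sub[OF that(1)] component_subset_coord_prime[OF comp[OF that(1)]] by blast
    show "krull_dim (mpoly_ring Quot I) \<le> 1" using assms(2) by simp
  qed
  have incomparable: "\<not> A Q \<subseteq> A Q'"
    if Q: "Q \<in> \<Q>" "Q' \<in> \<Q>" "Q \<noteq> Q'" "A Q' \<noteq> UNIV" for Q Q'
  proof
    assume le: "A Q \<subseteq> A Q'"
    obtain q where q: "q \<notin> A Q'" using Q(4) by blast
    have "A Q' \<subseteq> A Q"
    proof
      fix p assume p: "p \<in> A Q'"
      show "p \<in> A Q"
      proof (rule ccontr)
        assume "p \<notin> A Q"
        then have "p = q" by (rule codim[OF Q(1)]) (use le q in blast)
        then show False using p q by simp
      qed
    qed
    then show False using inj[OF Q(1,2)] le Q(3) by blast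
  qed
  have rad: "ideal_radical mpoly_ring Q = variables_ideal \<longleftrightarrow> A Q = UNIV" if "Q \<in> \<Q>" for Q
    unfolding ideal_radical_component[OF comp[OF that]] variables_ideal_eq
    using coord_prime_antimono_iff[of UNIV "A Q"] by auto
  have proper: "I \<noteq> UNIV" if "Q \<in> \<Q>" for Q
    using sub[OF that] one_notin_component[OF comp[OF that]] by blast
  let ?e = "\<lambda>Q. Suc (excess (A Q) (d Q))"
  show ?thesis
  proof (cases "\<exists>P\<in>\<Q>. A P = UNIV")
    case True
    then obtain P where P: "P \<in> \<Q>" "A P = UNIV" by blast
    define F where "F = \<Q> - {P}"
    define N where "N = max (?e P) (\<Sum>Q\<in>F. ?e Q)"
    have F: "finite F" "\<And>Q. Q \<in> F \<Longrightarrow> primary_component Q (A Q) (d Q)"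
      using fin\<Q> comp by (auto simp: F_def)
    have notP: "A Q \<noteq> UNIV" if "Q \<in> F" for Q
      using inj[of Q P] that P by (auto simp: F_def)
    have compP: "primary_component P UNIV (d P)" using comp[OF P(1)] P(2) by simp
    have \<Q>F: "\<Q> = insert P F" using P(1) by (auto simp: F_def)
    have strong: "strongly_absorbing mpoly_ring N I"
      unfolding I\<Q> \<Q>F
      by (rule strongly_absorbing_Inter_components_embedded[OF F compP])
        (simp_all add: N_def P(2))
    have not: "\<not> absorbing mpoly_ring N' I" if N': "N' < N" for N'
    \<comment> \<open>The larger one of the two numbers decides which critical product is used.\<close>
    proof (cases "?e P \<le> (\<Sum>Q\<in>F. ?e Q)")
      case True
      show ?thesis
      proof (rule not_absorbing_if_incomparable_components[OF F _ ideal])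
        show "\<not> A Q \<subseteq> A Q'" if "Q \<in> F" "Q' \<in> F" "Q \<noteq> Q'" for Q Q'
          by (rule incomparable) (use that notP in \<open>auto simp: F_def\<close>)
        show "I \<subseteq> Q" if "Q \<in> F" for Q using sub that by (simp add: F_def)
        show "ideal P mpoly_ring" by (rule primary_componentD(2)[OF compP])
        show "products_within (\<lambda>_. coord_prime UNIV) {..<\<Sum>Q\<in>F. ?e Q} P"
          by (rule products_within_const_mono[OF primary_componentD(2,5)[OF compP]])
            (use True P(2) in auto)
        show "\<Inter>F \<inter> P \<subseteq> I" unfolding I\<Q> \<Q>F by blast
        show "N' < (\<Sum>Q\<in>F. ?e Q)" using N' True by (simp add: N_def)
      qed
    next
      case False
      have d: "\<forall>i. 1 \<le> d P i" using primary_componentD(1)[OF compP] by blast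
      have "pure_power UNIV (d P) \<in> \<T>" using mem[OF P(1)] P(2) by simp
      note socle = top_monomial_socle_if_irredundant[OF \<T> this d]
      show ?thesis
      proof (rule not_absorbing_if_top_monomial_socle[OF ideal])
        show "I \<subseteq> pure_power UNIV (d P)" using sub[OF P(1)] primary_componentD(3)[OF compP] by blast
        show "\<forall>i\<in>UNIV. 1 \<le> d P i" using d by blast
        show "N' < Suc (excess UNIV (d P))" using N' False P(2) by (simp add: N_def)
        show "monomial (top_exponent UNIV (d P)) * variable i \<in> I" for i by (rule socle)
      qed
    qed
    have "N \<ge> 1" by (simp add: N_def)
    note omega = omega_eqI[OF ideal proper[OF P(1)] this strong not]
    have "max (noether_exponent mpoly_ring P) (\<Sum>Q'\<in>\<Q> - {P}. noether_exponent mpoly_ring Q') = enat N"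
      using sum_noether_exponent[of F A d, OF F(2)] noether_exponent_component[OF comp[OF P(1)]]
      by (simp add: F_def N_def)
    moreover have "Q = P" if "Q \<in> \<Q>" "ideal_radical mpoly_ring Q = variables_ideal" for Q
      using inj[OF that(1) P(1)] rad[OF that(1)] that(2) P(2) by simp
    ultimately show ?thesis using omega rad[OF P(1)] P by metis
  next
    case False
    then have notU: "A Q \<noteq> UNIV" if "Q \<in> \<Q>" for Q using that by blast
    define N where "N = (\<Sum>Q\<in>\<Q>. ?e Q)"
    have omega: "omega mpoly_ring I = enat N \<and> strong_omega mpoly_ring I = enat N"
    proof (cases "\<Q> = {}")
      case True
      then have "I = carrier mpoly_ring" using I\<Q> by simp
      then show ?thesis using True by (simp add: omega_def strong_omega_def N_def zero_enat_def)
    next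
      case False
      then obtain P where P: "P \<in> \<Q>" by blast
      have "?e P \<le> N" unfolding N_def using P fin\<Q> by (intro member_le_sum) auto
      then have "N \<ge> 1" by simp
      moreover have "strongly_absorbing mpoly_ring N I"
        unfolding I\<Q> by (rule strongly_absorbing_Inter_components[OF fin\<Q> comp]) (simp_all add: N_def)
      moreover have "\<not> absorbing mpoly_ring N' I" if N': "N' < N" for N'
      proof (rule not_absorbing_if_incomparable_components[OF fin\<Q> comp _ ideal])
        show "\<not> A Q \<subseteq> A Q'" if "Q \<in> \<Q>" "Q' \<in> \<Q>" "Q \<noteq> Q'" for Q Q'
          by (rule incomparable[OF that notU[OF that(2)]])
        show "ideal UNIV (mpoly_ring :: ('n, 'k) poly_n ring)" by (simp add: ideal_type_algebra_iff)
        show "products_within (\<lambda>_. coord_prime UNIV) {..<\<Sum>Q\<in>\<Q>. ?e Q} UNIV"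
          by (simp add: products_within_def)
        show "\<Inter>\<Q> \<inter> UNIV \<subseteq> I" unfolding I\<Q> by blast
        show "N' < (\<Sum>Q\<in>\<Q>. ?e Q)" using N' by (simp add: N_def)
      qed (use sub in blast)+
      ultimately show ?thesis using omega_eqI[OF ideal proper[OF P]] by blast
    qed
    moreover have "(\<Sum>Q\<in>\<Q>. noether_exponent mpoly_ring Q) = enat N"
      unfolding N_def by (rule sum_noether_exponent[OF comp])
    ultimately show ?thesis using rad notU by simp
  qed
qed

end
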